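(* There is a constant $C>0$ such that for every $n$, every set $T\subseteq V_n$ with $|T|$ even, and every vertex $v$ of $\operatorname{dom}(P_{T\text{-join}}(n))$, where $v$ is the characteristic vector of a $T$-join $J\subseteq E_n$, the extension complexity of the radial cone $K_{\operatorname{dom}(P_{T\text{-join}}(n))}(v)$ is at most $C\,|J|\,n^2$.
   Context: $K_n=(V_n,E_n)$ is the complete graph on $n$ nodes. For $T\subseteq V_n$ with $|T|$ even, a $T$-join is a set $J\subseteq E_n$ such that a node has odd degree in $(V_n,J)$ iff it lies in $T$. $P_{T\text{-join}}(n)$ is the convex hull of characteristic vectors of $T$-joins and $\operatorname{dom}(P_{T\text{-join}}(n)) = P_{T\text{-join}}(n)+\mathbb{R}^{E_n}_+$ (its vertices are the characteristic vectors of inclusion-minimal $T$-joins). The radial cone $K_P(v)$ of a polyhedron $P$ at $v\in P$ is the polyhedron defined by all linear inequalities valid for $P$ satisfied with equality by $v$. Extension complexity $\operatorname{xc}(P)$ is the minimum number of facets of a polyhedron $Q$ with $P=\pi(Q)$ for a linear map $\pi$.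
   Formalization: The T-join J is assumed nonempty: for T empty the only vertex is 0 with J empty, whose radial cone is the nonnegative orthant with positive extension complexity once n ≥ 2, so the bound C|J|n² = 0 fails there. *)

theory Defs
  imports Main "HOL-Library.Indicator_Function"
begin

text \<open>A vector of R^D (D a finite coordinate set) is a real-valued function that
  vanishes outside D.\<close>
definition fspace :: "'a set \<Rightarrow> ('a \<Rightarrow> real) set" where
  "fspace D = {x. \<forall>i. i \<notin> D \<longrightarrow> x i = 0}"

definition dotp :: "'a set \<Rightarrow> ('a \<Rightarrow> real) \<Rightarrow> ('a \<Rightarrow> real) \<Rightarrow> real" where
  "dotp D a x = (\<Sum>i\<in>D. a i * x i)"

definition conv_hull :: "('a \<Rightarrow> real) set \<Rightarrow> ('a \<Rightarrow> real) set" where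
  "conv_hull S = {x. \<exists>F u. finite F \<and> F \<subseteq> S \<and> F \<noteq> {} \<and> (\<forall>y\<in>F. 0 \<le> u y) \<and>
      sum u F = 1 \<and> x = (\<lambda>i. \<Sum>y\<in>F. u y * y i)}"

definition dominant :: "'a set \<Rightarrow> ('a \<Rightarrow> real) set \<Rightarrow> ('a \<Rightarrow> real) set" where
  "dominant D P = {x. \<exists>p\<in>P. \<exists>r\<in>fspace D. (\<forall>i. 0 \<le> r i) \<and> x = (\<lambda>i. p i + r i)}"

definition is_vertex :: "('a \<Rightarrow> real) \<Rightarrow> ('a \<Rightarrow> real) set \<Rightarrow> bool" where
  "is_vertex v P \<longleftrightarrow> v \<in> P \<and>
     \<not> (\<exists>a\<in>P. \<exists>b\<in>P. \<exists>t::real. a \<noteq> b \<and> 0 < t \<and> t < 1 \<and> v = (\<lambda>i. (1 - t) * a i + t * b i))"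

definition radial_cone :: "'a set \<Rightarrow> ('a \<Rightarrow> real) set \<Rightarrow> ('a \<Rightarrow> real) \<Rightarrow> ('a \<Rightarrow> real) set" where
  "radial_cone D P v = {x \<in> fspace D. \<forall>a b. (\<forall>y\<in>P. dotp D a y \<le> b) \<and> dotp D a v = b
       \<longrightarrow> dotp D a x \<le> b}"

definition polyhedron_in :: "'a set \<Rightarrow> ('a \<Rightarrow> real) set \<Rightarrow> bool" where
  "polyhedron_in D Q \<longleftrightarrow> finite D \<and>
     (\<exists>(k::nat) A b. Q = {x \<in> fspace D. \<forall>j<k. dotp D (A j) x \<le> b j})"

definition face_in :: "'a set \<Rightarrow> ('a \<Rightarrow> real) set \<Rightarrow> ('a \<Rightarrow> real) set \<Rightarrow> bool" where
  "face_in D F Q \<longleftrightarrow> (\<exists>a b. (\<forall>y\<in>Q. dotp D a y \<le> b) \<and> F = {y \<in> Q. dotp D a y = b})"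

definition aff_indep :: "('a \<Rightarrow> real) set \<Rightarrow> bool" where
  "aff_indep B \<longleftrightarrow> finite B \<and> (\<forall>u. sum u B = 0 \<and> (\<forall>i. (\<Sum>y\<in>B. u y * y i) = 0)
       \<longrightarrow> (\<forall>y\<in>B. u y = 0))"

text \<open>Affine dimension: maximal number of affinely independent points, minus one
  (the empty set has dimension -1).\<close>
definition adim :: "('a \<Rightarrow> real) set \<Rightarrow> int" where
  "adim S = Max {int (card B) | B. B \<subseteq> S \<and> aff_indep B} - 1"

definition facet_in :: "'a set \<Rightarrow> ('a \<Rightarrow> real) set \<Rightarrow> ('a \<Rightarrow> real) set \<Rightarrow> bool" where
  "facet_in D F Q \<longleftrightarrow> face_in D F Q \<and> F \<noteq> {} \<and> adim F = adim Q - 1"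

definition lin_map :: "'a set \<Rightarrow> nat \<Rightarrow> ('a \<Rightarrow> nat \<Rightarrow> real) \<Rightarrow> (nat \<Rightarrow> real) \<Rightarrow> ('a \<Rightarrow> real)" where
  "lin_map D m M y = (\<lambda>e. if e \<in> D then (\<Sum>j<m. M e j * y j) else 0)"

definition xc :: "'a set \<Rightarrow> ('a \<Rightarrow> real) set \<Rightarrow> nat" where
  "xc D P = (LEAST k. \<exists>m Q M. polyhedron_in {..<m} Q \<and> P = lin_map D m M ` Q \<and>
      card {F. facet_in {..<m} F Q} = k)"

definition Vn :: "nat \<Rightarrow> nat set" where "Vn n = {..<n}"

definition En :: "nat \<Rightarrow> nat set set" where "En n = {e. e \<subseteq> Vn n \<and> card e = 2}"

definition is_Tjoin :: "nat \<Rightarrow> nat set \<Rightarrow> nat set set \<Rightarrow> bool" where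
  "is_Tjoin n T J \<longleftrightarrow> J \<subseteq> En n \<and>
     (\<forall>v\<in>Vn n. odd (card {e\<in>J. v \<in> e}) \<longleftrightarrow> v \<in> T)"

definition P_Tjoin :: "nat \<Rightarrow> nat set \<Rightarrow> (nat set \<Rightarrow> real) set" where
  "P_Tjoin n T = conv_hull {indicator J | J. is_Tjoin n T J}"

definition dom_P_Tjoin :: "nat \<Rightarrow> nat set \<Rightarrow> (nat set \<Rightarrow> real) set" where
  "dom_P_Tjoin n T = dominant (En n) (P_Tjoin n T)"

end

theory Submission
  imports Defs
begin

text \<open>
  The radial cone at \<open>J\<close> is described by \<open>x e \<ge> 0\<close> for \<open>e \<notin> J\<close> and \<open>x(\<delta>(S)) \<ge> 1\<close> for the cuts
  \<open>\<delta>(S)\<close> that meet \<open>J\<close> in exactly one edge. These inequalities are valid and tight because a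
  \<open>T\<close>-join meets such a cut in an odd number of edges. Conversely, a valid inequality tight at \<open>J\<close>
  is \<open>c x \<ge> c(J)\<close> with \<open>c \<ge> 0\<close> and \<open>J\<close> a \<open>c\<close>-minimal \<open>T\<close>-join. If \<open>c\<close> is integral, even on
  Eulerian edge sets and \<open>c(J) > 0\<close>, then there is a cut \<open>\<delta>(S)\<close> meeting \<open>J\<close> in one edge such that
  \<open>J\<close> remains minimal when \<open>c\<close> decreases by one on \<open>\<delta>(S)\<close>; induction on \<open>c(J)\<close> and rounding give
  \<open>c x \<ge> c(J)\<close> on the cone.

  For fixed \<open>f \<in> J\<close>, the cut inequalities at cuts meeting \<open>J\<close> in \<open>f\<close> only are equivalent, by
  max-flow min-cut, to the existence of a flow of value \<open>1 - x f\<close> between the ends of \<open>f\<close>. This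
  takes \<open>O(n\<^sup>2)\<close> variables and inequalities for every \<open>f\<close>, and a polyhedron has at most as many
  facets as defining inequalities.
\<close>

section \<open>Joins and cuts\<close>

text \<open>The boundary of an edge set over the two-element field: \<open>T\<close>-joins are the
  edge sets with boundary \<open>T\<close>, Eulerian sets those with empty boundary.\<close>

definition odd_nodes :: "'v set set \<Rightarrow> 'v set" where
  "odd_nodes Q = {v. odd (card {e\<in>Q. v \<in> e})}"

definition cut :: "'v set \<Rightarrow> 'v set set" where
  "cut S = {e. e \<inter> S \<noteq> {} \<and> \<not> e \<subseteq> S}"

text \<open>Connectivity without paths: a witness is any subset of \<open>F\<close> with boundary
  \<open>a + b\<close> modulo 2, so the empty set serves for \<open>a = b\<close> and adding
  witnesses gives transitivity.\<close>

definition joined :: "'v set set \<Rightarrow> 'v \<Rightarrow> 'v \<Rightarrow> bool" where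
  "joined F a b \<longleftrightarrow> (\<exists>Q\<subseteq>F. odd_nodes Q = sym_diff {a} {b})"

lemma even_card_sym_diff:
  assumes "finite A" "finite B"
  shows "even (card (sym_diff A B)) \<longleftrightarrow> (even (card A) \<longleftrightarrow> even (card B))"
proof -
  have "card (sym_diff A B) = card (A - B) + card (B - A)"
    using assms by (intro card_Un_disjoint) auto
  moreover have "card A = card (A - B) + card (A \<inter> B)"
    using assms by (subst card_Un_disjoint[symmetric]) (auto intro: arg_cong[where f=card])
  moreover have "card B = card (B - A) + card (A \<inter> B)"
    using assms by (subst card_Un_disjoint[symmetric]) (auto intro: arg_cong[where f=card])
  ultimately show ?thesis by auto
qed

lemma odd_nodes_sym_diff:
  assumes "finite A" "finite B"
  shows "odd_nodes (sym_diff A B) = sym_diff (odd_nodes A) (odd_nodes B)"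
proof -
  have "{e \<in> sym_diff A B. v \<in> e} = sym_diff {e\<in>A. v \<in> e} {e\<in>B. v \<in> e}" for v
    by auto
  then have "odd (card {e \<in> sym_diff A B. v \<in> e}) \<longleftrightarrow>
      (odd (card {e\<in>A. v \<in> e}) \<longleftrightarrow> \<not> odd (card {e\<in>B. v \<in> e}))" for v
    using even_card_sym_diff[of "{e\<in>A. v \<in> e}" "{e\<in>B. v \<in> e}"] assms by auto
  then show ?thesis unfolding odd_nodes_def by blast
qed

lemma odd_nodes_empty [simp]: "odd_nodes {} = {}"
  by (simp add: odd_nodes_def)

lemma odd_nodes_single [simp]: "odd_nodes {e} = e"
proof -
  have "{e' \<in> {e}. v \<in> e'} = (if v \<in> e then {e} else {})" for v by auto
  then show ?thesis unfolding odd_nodes_def by auto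
qed

lemma odd_nodes_subset: "odd_nodes Q \<subseteq> \<Union>Q"
proof
  fix v assume "v \<in> odd_nodes Q"
  then have "card {e\<in>Q. v \<in> e} \<noteq> 0" by (intro notI) (simp add: odd_nodes_def)
  then have "{e\<in>Q. v \<in> e} \<noteq> {}" by (metis card.empty)
  then show "v \<in> \<Union>Q" by blast
qed

text \<open>Both parities are additive under symmetric difference, and for a single edge both say
  that exactly one of its ends lies in \<open>S\<close>.\<close>

lemma odd_card_cut:
  assumes "finite Q" "\<And>e. e \<in> Q \<Longrightarrow> card e = 2"
  shows "odd (card (Q \<inter> cut S)) \<longleftrightarrow> odd (card (odd_nodes Q \<inter> S))"
  using assms
proof (induction Q)
  case empty
  then show ?case by simp
next
  case (insert e Q)
  have sd: "insert e Q = sym_diff Q {e}" using insert.hyps by auto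
  obtain a b where ab: "e = {a, b}" "a \<noteq> b"
    using insert.prems[of e] by (auto simp: card_2_iff)
  have "finite (\<Union>Q)" using insert.hyps insert.prems
    by (intro finite_Union) (auto intro: card_ge_0_finite)
  then have fin: "finite (odd_nodes Q)" using odd_nodes_subset finite_subset by metis
  have eS: "odd (card (e \<inter> S)) \<longleftrightarrow> e \<in> cut S"
    using ab by (cases "a \<in> S"; cases "b \<in> S") (auto simp: cut_def)
  have "odd_nodes (insert e Q) \<inter> S = sym_diff (odd_nodes Q \<inter> S) (e \<inter> S)"
    unfolding sd using odd_nodes_sym_diff[of Q "{e}"] insert.hyps by auto
  then have "odd (card (odd_nodes (insert e Q) \<inter> S)) \<longleftrightarrow>
      (odd (card (odd_nodes Q \<inter> S)) \<longleftrightarrow> \<not> e \<in> cut S)"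
    using even_card_sym_diff[of "odd_nodes Q \<inter> S" "e \<inter> S"] fin eS ab by auto
  moreover have "odd (card (insert e Q \<inter> cut S)) \<longleftrightarrow>
      (odd (card (Q \<inter> cut S)) \<longleftrightarrow> \<not> e \<in> cut S)"
    using insert.hyps by (cases "e \<in> cut S") auto
  ultimately show ?case using insert by auto
qed

lemma joinedE:
  assumes "joined F a b"
  obtains Q where "Q \<subseteq> F" "odd_nodes Q = sym_diff {a} {b}"
  using assms unfolding joined_def by (elim exE conjE)

lemma joined_refl: "joined F a a"
  unfolding joined_def by (rule exI[of _ "{}"]) simp

lemma joined_sym: "joined F a b \<Longrightarrow> joined F b a"
  unfolding joined_def by (simp add: Un_commute)

lemma joined_trans:
  assumes "finite F" "joined F a b" "joined F b c"
  shows "joined F a c"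
proof -
  obtain P Q where P: "P \<subseteq> F" "odd_nodes P = sym_diff {a} {b}"
    and Q: "Q \<subseteq> F" "odd_nodes Q = sym_diff {b} {c}"
    using assms(2,3) by (elim joinedE)
  have "odd_nodes (sym_diff P Q) = sym_diff {a} {c}"
    using odd_nodes_sym_diff[of P Q] P Q assms(1) finite_subset[of _ F] by auto
  moreover have "sym_diff P Q \<subseteq> F" using P Q by auto
  ultimately show ?thesis unfolding joined_def by blast
qed

lemma joined_edge: "{a, b} \<in> F \<Longrightarrow> a \<noteq> b \<Longrightarrow> joined F a b"
  unfolding joined_def by (rule exI[of _ "{{a, b}}"]) auto

lemma sum_if_mem:
  assumes "finite E" "A \<subseteq> E"
  shows "sum c A = (\<Sum>e\<in>E. if e \<in> A then c e else (0::'b::comm_monoid_add))"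
  using sum.inter_restrict[OF assms(1), of c A] assms(2) by (simp add: Int_absorb1)

text \<open>The crossing edges of \<open>D\<close> at \<open>S\<close> are paired up by components of \<open>D\<close> outside \<open>S\<close>:
  a component without \<open>s\<close> meets an even number of them.\<close>

lemma two_cut_edges_joined_outside:
  assumes D: "finite D" "\<And>e. e \<in> D \<Longrightarrow> card e = 2" "odd_nodes D = {s, t}"
    and st: "t \<in> S" "s \<notin> S" and two: "card (D \<inter> cut S) \<ge> 2"
  obtains a1 b1 a2 b2 where "{a1, b1} \<in> D" "{a2, b2} \<in> D" "{a1, b1} \<noteq> {a2, b2}"
    "a1 \<in> S" "a2 \<in> S" "b1 \<notin> S" "b2 \<notin> S" "joined {e\<in>D. e \<inter> S = {}} b1 b2"
proof -
  define U where "U = {e\<in>D. e \<inter> S = {}}"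
  have fU: "finite U" using D by (simp add: U_def)
  have ends: "\<exists>a b. e = {a, b} \<and> a \<in> S \<and> b \<notin> S" if "e \<in> D \<inter> cut S" for e
  proof -
    have "card e = 2" using D(2) that by blast
    then obtain a b where "e = {a, b}" by (auto simp: card_2_iff)
    then show ?thesis using that by (cases "a \<in> S") (auto simp: cut_def insert_commute)
  qed
  have other: "\<exists>a2 b2. {a2, b2} \<in> D \<and> {a, b} \<noteq> {a2, b2} \<and> a2 \<in> S \<and> b2 \<notin> S \<and> joined U b b2"
    if ab: "{a, b} \<in> D" "a \<in> S" "b \<notin> S" and ns: "\<not> joined U b s" for a b
  proof -
    \<comment> \<open>\<open>K\<close> is the component of \<open>b\<close> outside
      \<open>S\<close>. It contains neither \<open>s\<close> nor \<open>t\<close>, so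
      \<open>D\<close> leaves it an even number of times, and an edge of \<open>D\<close> leaving it
      can only end in \<open>S\<close>.\<close>
    define K where "K = {w. joined U b w}"
    have KS: "w \<notin> S" if "w \<in> K" for w
    proof
      assume "w \<in> S"
      have "joined U b w" using that by (simp add: K_def)
      then obtain Q where Q: "Q \<subseteq> U" "odd_nodes Q = sym_diff {b} {w}"
        by (elim joinedE)
      have "w \<in> odd_nodes Q" unfolding Q(2) using \<open>w \<in> S\<close> ab by auto
      then have "w \<in> \<Union>U" using odd_nodes_subset[of Q] Q(1) by blast
      then show False using \<open>w \<in> S\<close> by (auto simp: U_def)
    qed
    have "odd_nodes D \<inter> K = {}" using D(3) ns KS st by (auto simp: K_def)
    then have ev: "even (card (D \<inter> cut K))" using odd_card_cut[OF D(1,2), of K] by auto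
    have bK: "b \<in> K" by (simp add: K_def joined_refl)
    have "{a, b} \<in> D \<inter> cut K" using ab bK KS by (auto simp: cut_def)
    then have "D \<inter> cut K \<noteq> {{a, b}}" "{a, b} \<in> D \<inter> cut K" using ev by auto
    then obtain e where e: "e \<in> D" "e \<in> cut K" "e \<noteq> {a, b}" by blast
    obtain u w where uw: "e = {u, w}" "u \<noteq> w" "u \<in> K" "w \<notin> K"
    proof -
      obtain u w where *: "e = {u, w}" "u \<noteq> w" using D(2) e(1) by (meson card_2_iff)
      show ?thesis
        using that[of u w] that[of w u] * e(2) by (auto simp: cut_def)
    qed
    have "w \<in> S"
    proof (rule ccontr)
      assume "w \<notin> S"
      then have "e \<in> U" using e uw KS by (auto simp: U_def)
      then have "joined U u w" using uw joined_edge by metis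
      then have "w \<in> K" using uw(3) joined_trans[OF fU] by (auto simp: K_def)
      then show False using uw by simp
    qed
    then show ?thesis
      using e uw KS by (intro exI[of _ w] exI[of _ u]) (auto simp: K_def insert_commute)
  qed
  have "\<not> (\<forall>e1\<in>D \<inter> cut S. \<forall>e2\<in>D \<inter> cut S. e1 = e2)"
    using two card_le_Suc0_iff_eq[of "D \<inter> cut S"] D(1) by auto
  then obtain e1 e2 where e12: "e1 \<in> D \<inter> cut S" "e2 \<in> D \<inter> cut S" "e1 \<noteq> e2"
    by blast
  obtain a1 b1 where e1: "e1 = {a1, b1}" "a1 \<in> S" "b1 \<notin> S" using ends e12 by blast
  obtain a2 b2 where e2: "e2 = {a2, b2}" "a2 \<in> S" "b2 \<notin> S" using ends e12 by blast
  \<comment> \<open>If both outer ends are connected to \<open>s\<close>, they are connected to each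
    other; otherwise one component misses \<open>s\<close> and \<open>other\<close> gives it a
    second crossing edge.\<close>
  consider (both) "joined U b1 b2" | (fst) "\<not> joined U b1 s" | (snd) "\<not> joined U b2 s"
    using joined_trans[OF fU, of b1 s b2] joined_sym[of U b2 s] by blast
  then show ?thesis
  proof cases
    case both
    show ?thesis
      using that[of a1 b1 a2 b2] both e1 e2 e12 unfolding U_def by simp
  next
    case fst
    obtain a b where "{a, b} \<in> D" "{a1, b1} \<noteq> {a, b}" "a \<in> S" "b \<notin> S" "joined U b1 b"
      using other[OF _ e1(2,3) fst] e12(1) e1(1) by auto
    then show ?thesis using that[of a1 b1 a b] e1 e12 unfolding U_def by simp
  next
    case snd
    obtain a b where "{a, b} \<in> D" "{a2, b2} \<noteq> {a, b}" "a \<in> S" "b \<notin> S" "joined U b2 b"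
      using other[OF _ e2(2,3) snd] e12(2) e2(1) by auto
    then show ?thesis using that[of a2 b2 a b] e2 e12 unfolding U_def by simp
  qed
qed

text \<open>Among all edge sets whose odd nodes differ from those of \<open>J\<close> in exactly two nodes \<open>s\<close>, \<open>t\<close>,
  let \<open>J0\<close> have minimal weight, and let \<open>S\<close> be the zero-weight component of \<open>t\<close>. By minimality every
  such optimum avoids the cut. If another join \<open>J'\<close> crosses it at least twice, then \<open>J'\<close> and \<open>J0\<close>
  can exchange a closed trail \<open>C\<close> that uses two crossing edges; this makes \<open>J0\<close> cross the cut and hence, by
  parity, heavier by at least two, so \<open>J'\<close> gets lighter by at least two.\<close>

lemma exists_reducing_cut:
  fixes c :: "'v set \<Rightarrow> nat"
  assumes E: "finite E" "\<And>e. e \<in> E \<Longrightarrow> card e = 2" and J: "J \<subseteq> E"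
    and even: "\<And>C. C \<subseteq> E \<Longrightarrow> odd_nodes C = {} \<Longrightarrow> even (sum c C)"
    and opt: "\<And>J'. J' \<subseteq> E \<Longrightarrow> odd_nodes J' = odd_nodes J \<Longrightarrow> sum c J \<le> sum c J'"
    and pos: "sum c J > 0"
  obtains S where "\<And>e. e \<in> E \<inter> cut S \<Longrightarrow> c e \<ge> 1" "card (J \<inter> cut S) = 1"
    "\<And>J'. J' \<subseteq> E \<Longrightarrow> odd_nodes J' = odd_nodes J \<Longrightarrow>
        sum c J + card (J' \<inter> cut S) \<le> sum c J' + 1"
proof -
  have fin: "finite A" if "A \<subseteq> E" for A using that E(1) finite_subset by blast
  have od: "odd_nodes (sym_diff A B) = sym_diff (odd_nodes A) (odd_nodes B)"
    if "A \<subseteq> E" "B \<subseteq> E" for A B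
    using that by (intro odd_nodes_sym_diff fin)
  define near where "near s t J0 \<longleftrightarrow> s \<noteq> t \<and> J0 \<subseteq> E \<and>
    odd_nodes J0 = sym_diff (odd_nodes J) {s, t}" for s t J0
  define Z where "Z = {e\<in>E. c e = 0}"
  obtain f where f: "f \<in> J" "c f > 0"
    using pos by (metis not_gr_zero sum.neutral)
  have "card f = 2" using f J E(2) by blast
  then obtain s1 t1 where st1: "f = {s1, t1}" "s1 \<noteq> t1" by (meson card_2_iff)
  \<comment> \<open>Deleting an edge of positive weight from \<open>J\<close> gives an admissible
    competitor, which puts the minimum \<open>m\<close> strictly below the weight of
    \<open>J\<close>.\<close>
  have "sym_diff J {f} = J - {f}" using f by auto
  moreover have "odd_nodes (sym_diff J {f}) = sym_diff (odd_nodes J) {s1, t1}"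
    using od[of J "{f}"] f(1) J st1(1) by simp blast
  ultimately have near1: "near s1 t1 (J - {f})"
    using J st1(2) unfolding near_def by simp blast
  have less1: "sum c (J - {f}) < sum c J"
    using sum.remove[OF fin[OF J] f(1), of c] f(2) by simp
  define m where "m = (LEAST k. \<exists>s t J0. near s t J0 \<and> sum c J0 = k)"
  have ex: "\<exists>s t J0. near s t J0 \<and> sum c J0 = m"
    unfolding m_def by (rule LeastI_ex) (use near1 in blast)
  have min: "m \<le> sum c J0" if "near s t J0" for s t J0
    unfolding m_def by (rule Least_le) (use that in blast)
  obtain s t J0 where J0: "near s t J0" "sum c J0 = m" using ex by blast
  have mJ: "m < sum c J" using min[OF near1] less1 by simp
  define S where "S = {w. joined Z t w}"
  have ZE: "Z \<subseteq> E" by (auto simp: Z_def)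
  have fZ: "finite Z" by (rule fin[OF ZE])
  have J0E: "J0 \<subseteq> E" and J0on: "odd_nodes J0 = sym_diff (odd_nodes J) {s, t}" and st: "s \<noteq> t"
    using J0(1) unfolding near_def by simp_all
  have tS: "t \<in> S" by (simp add: S_def joined_refl)
  have zero: "sum c Q = 0" if "Q \<subseteq> Z" for Q
    using that by (intro sum.neutral) (auto simp: Z_def)
  have wt_le: "sum c (sym_diff A Q) \<le> sum c A" if "A \<subseteq> E" "Q \<subseteq> Z" for A Q
  proof -
    have "sum c (sym_diff A Q) \<le> sum c (A \<union> Q)"
      using that fin[of A] finite_subset[OF _ fZ, of Q] by (intro sum_mono2) auto
    also have "\<dots> \<le> sum c A + sum c Q"
      using that fin[of A] finite_subset[OF _ fZ, of Q]
      by (metis sum.union_inter le_add1)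
    finally show ?thesis using zero that by simp
  qed
  \<comment> \<open>Otherwise a zero-weight set would connect \<open>s\<close> and \<open>t\<close>,
    and adding it to \<open>J0\<close> modulo 2 would give a join lighter than
    \<open>J\<close>.\<close>
  have sS: "s \<notin> S"
  proof
    assume "s \<in> S"
    then have "joined Z t s" by (simp add: S_def)
    then obtain Q where Q: "Q \<subseteq> Z" "odd_nodes Q = sym_diff {t} {s}"
      by (elim joinedE)
    have QE: "Q \<subseteq> E" using Q(1) ZE by (rule subset_trans)
    have "odd_nodes (sym_diff J0 Q) = odd_nodes J"
      unfolding od[OF J0E QE] J0on Q(2) using st by auto
    moreover have "sym_diff J0 Q \<subseteq> E" using QE J0E by blast
    ultimately have "sum c J \<le> sum c (sym_diff J0 Q)" by (intro opt)
    also have "\<dots> \<le> sum c J0" by (rule wt_le[OF J0E Q(1)])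
    finally show False using mJ J0(2) by simp
  qed
  have cpos: "c e \<ge> 1" if "e \<in> E \<inter> cut S" for e
  proof (rule ccontr)
    assume "\<not> 1 \<le> c e"
    then have eZ: "e \<in> Z" using that by (simp add: Z_def)
    have "card e = 2" using E(2) that by blast
    then obtain a b where ab: "e = {a, b}" "a \<noteq> b" by (meson card_2_iff)
    have "joined Z a b" "joined Z b a"
      using joined_edge ab eZ joined_sym by metis+
    then have "a \<in> S \<longleftrightarrow> b \<in> S" using joined_trans[OF fZ] by (auto simp: S_def)
    then show False using that ab by (auto simp: cut_def)
  qed
  \<comment> \<open>A crossing edge \<open>e\<close> has positive weight. Replacing it by a
    zero-weight connection from \<open>t\<close> to its inner end moves the defect from
    \<open>s\<close>, \<open>t\<close> to \<open>s\<close>, \<open>b\<close> at weight below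
    \<open>m\<close>; if \<open>b = s\<close>, the result is a join lighter than
    \<open>J\<close>.\<close>
  have avoid: "K \<inter> cut S = {}" if K: "near s t K" "sum c K = m" for K
  proof (rule ccontr)
    assume "K \<inter> cut S \<noteq> {}"
    then obtain e where e: "e \<in> K" "e \<in> cut S" by blast
    have KE: "K \<subseteq> E" using K by (simp add: near_def)
    have "card e = 2" using E(2) e KE by blast
    then obtain u w where uw: "e = {u, w}" "u \<noteq> w" by (meson card_2_iff)
    obtain a b where ab: "e = {a, b}" "a \<noteq> b" "a \<in> S" "b \<notin> S"
    proof (cases "u \<in> S")
      case True
      then show ?thesis using that[of u w] e(2) uw by (auto simp: cut_def)
    next
      case False
      then show ?thesis using that[of w u] e(2) uw by (auto simp: cut_def)
    qed
    have "joined Z t a" using ab by (simp add: S_def)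
    then obtain Q where Q: "Q \<subseteq> Z" "odd_nodes Q = sym_diff {t} {a}"
      by (elim joinedE)
    define K' where "K' = sym_diff (K - {e}) Q"
    have c1: "sum c (K - {e}) < m"
      using sum.remove[OF fin[OF KE] e(1), of c] cpos[of e] e KE K(2) by auto
    have QE: "Q \<subseteq> E" using Q(1) ZE by (rule subset_trans)
    have KeE: "K - {e} \<subseteq> E" using KE by blast
    have c2: "sum c K' < m" using wt_le[OF KeE Q(1)] c1 unfolding K'_def by linarith
    have K'E: "K' \<subseteq> E" unfolding K'_def using KeE QE by blast
    have "K - {e} = sym_diff K {e}" using e by auto
    then have oe: "odd_nodes (K - {e}) = sym_diff (odd_nodes K) e"
      using od[OF KE, of "{e}"] e(1) KE by simp blast
    have oK: "odd_nodes K = sym_diff (odd_nodes J) {s, t}" using K(1) unfolding near_def by simp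
    have bt: "b \<noteq> t" and as: "a \<noteq> s" using ab tS sS by metis+
    have on: "odd_nodes K' = sym_diff (odd_nodes J) (sym_diff {s} {b})"
      unfolding K'_def od[OF KeE QE] oe oK Q(2) unfolding ab(1) using ab(2) st bt as by auto
    show False
    proof (cases "b = s")
      case True
      then have "odd_nodes K' = odd_nodes J" unfolding on by simp
      then have "sum c J \<le> sum c K'" using K'E by (intro opt)
      then show False using c2 mJ by simp
    next
      case False
      then have "sym_diff {s} {b} = {s, b}" by auto
      then have "near s b K'" using on K'E False unfolding near_def by simp
      then show False using min[of s b K'] c2 by simp
    qed
  qed
  \<comment> \<open>Induction on the number of crossings, which the exchange lowers by two; with at
    most one crossing the claim is the optimality of \<open>J\<close>.\<close>
  have key: "sum c J + card (J' \<inter> cut S) \<le> sum c J' + 1"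
    if "J' \<subseteq> E" "odd_nodes J' = odd_nodes J" for J'
    using that
  proof (induction "card (J' \<inter> cut S)" arbitrary: J' rule: less_induct)
    case less
    show ?case
    proof (cases "card (J' \<inter> cut S) \<le> 1")
      case True
      then show ?thesis using opt[OF less.prems] by simp
    next
      case False
      define D where "D = sym_diff J' J0"
      have DE: "D \<subseteq> E" unfolding D_def using less.prems(1) J0E by blast
      have Don: "odd_nodes D = {s, t}"
        unfolding D_def od[OF less.prems(1) J0E] less.prems(2) J0on by auto
      have Dcut: "D \<inter> cut S = J' \<inter> cut S" using avoid[OF J0] by (auto simp: D_def)
      have D2: "card (D \<inter> cut S) \<ge> 2" using False by (simp add: Dcut)
      have Dc: "\<And>e. e \<in> D \<Longrightarrow> card e = 2" using DE E by blast
      obtain a1 b1 a2 b2 where ab: "{a1, b1} \<in> D" "{a2, b2} \<in> D" "{a1, b1} \<noteq> {a2, b2}"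
        "a1 \<in> S" "a2 \<in> S" "b1 \<notin> S" "b2 \<notin> S" and jn: "joined {e\<in>D. e \<inter> S = {}} b1 b2"
        by (rule two_cut_edges_joined_outside[OF fin[OF DE] Dc Don tS sS D2])
      obtain Q where Q: "Q \<subseteq> {e\<in>D. e \<inter> S = {}}" "odd_nodes Q = sym_diff {b1} {b2}"
        using jn by (elim joinedE)
      \<comment> \<open>Inside \<open>S\<close> the trail is closed up at no cost: \<open>a1\<close>
        and \<open>a2\<close> lie in the same zero-weight component.\<close>
      have "joined Z a1 a2"
        using ab(4,5) joined_sym[of Z t a1] joined_trans[OF fZ, of a1 t a2] by (simp add: S_def)
      then obtain R where R: "R \<subseteq> Z" "odd_nodes R = sym_diff {a1} {a2}"
        by (elim joinedE)
      define e1 where "e1 = {a1, b1}"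
      define e2 where "e2 = {a2, b2}"
      have e12: "e1 \<in> D" "e2 \<in> D" "e1 \<noteq> e2" "e1 \<in> cut S" "e2 \<in> cut S"
        using ab unfolding e1_def e2_def cut_def by blast+
      have RE: "R \<subseteq> E" using R(1) ZE by (rule subset_trans)
      have QD: "Q \<subseteq> D" using Q(1) by blast
      have QE: "Q \<subseteq> E" using QD DE by (rule subset_trans)
      have Rcut: "R \<inter> cut S = {}"
      proof (rule ccontr)
        assume "R \<inter> cut S \<noteq> {}"
        then obtain e where "e \<in> R" "e \<in> cut S" by blast
        moreover have "c e = 0" using \<open>e \<in> R\<close> R(1) by (auto simp: Z_def)
        ultimately show False using cpos[of e] RE by auto
      qed
      have Qcut: "Q \<inter> cut S = {}" using Q(1) unfolding cut_def by blast
      define B where "B = {e1, e2}"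
      have BD: "B \<subseteq> D" "B \<subseteq> cut S" using e12 by (simp_all add: B_def)
      have BE: "B \<subseteq> E" using BD(1) DE by (rule subset_trans)
      have QRE: "sym_diff Q R \<subseteq> E" using QE RE by blast
      define C where "C = sym_diff (sym_diff Q R) B"
      have CE: "C \<subseteq> E" unfolding C_def using QRE BE by blast
      have "B = sym_diff {e1} {e2}" using e12(3) by (auto simp: B_def)
      then have Bon: "odd_nodes B = sym_diff e1 e2"
        using odd_nodes_sym_diff[of "{e1}" "{e2}"] by simp
      have ne: "a1 \<noteq> b1" "a1 \<noteq> b2" "a2 \<noteq> b1" "a2 \<noteq> b2" using ab(4-7) by metis+
      have Con: "odd_nodes C = {}"
        unfolding C_def od[OF QRE BE] od[OF QE RE] Bon Q(2) R(2) e1_def e2_def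
        using ne by auto
      have Ccut: "C \<inter> cut S = B" unfolding C_def using Rcut Qcut BD(2) by blast
      have Cpos: "e \<in> D" if "e \<in> C" "c e > 0" for e
      proof -
        have "e \<notin> R" using that(2) R(1) by (auto simp: Z_def)
        then show ?thesis using that(1) QD BD(1) unfolding C_def by blast
      qed
      define J1 where "J1 = sym_diff J' C"
      define J2 where "J2 = sym_diff J0 C"
      have E12: "J1 \<subseteq> E" "J2 \<subseteq> E" unfolding J1_def J2_def using less.prems(1) J0E CE by auto
      have on1: "odd_nodes J1 = odd_nodes J"
        unfolding J1_def od[OF less.prems(1) CE] Con less.prems(2) by simp
      have on2: "odd_nodes J2 = odd_nodes J0"
        unfolding J2_def od[OF J0E CE] Con by simp
      \<comment> \<open>An edge of \<open>C\<close> of positive weight lies in exactly one of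
        \<open>J'\<close> and \<open>J0\<close>, so switching along \<open>C\<close> only moves
        weight between the two.\<close>
      have swap: "sum c J' + sum c J0 = sum c J1 + sum c J2"
      proof -
        have eq: "(if e \<in> J' then c e else 0) + (if e \<in> J0 then c e else 0) =
            (if e \<in> J1 then c e else 0) + (if e \<in> J2 then c e else 0)" for e
        proof (cases "c e = 0 \<or> e \<notin> C")
          case True
          have "e \<in> J1 \<longleftrightarrow> e \<in> J'" "e \<in> J2 \<longleftrightarrow> e \<in> J0" if "e \<notin> C"
            unfolding J1_def J2_def using that by blast+
          then show ?thesis using True by (cases "c e = 0") simp_all
        next
          case False
          then have "e \<in> D" using Cpos[of e] by simp
          then have 1: "e \<in> J' \<longleftrightarrow> e \<notin> J0" unfolding D_def by blast
          have 2: "e \<in> J1 \<longleftrightarrow> e \<notin> J'" "e \<in> J2 \<longleftrightarrow> e \<notin> J0"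
            unfolding J1_def J2_def using False by blast+
          show ?thesis unfolding 2 using 1 by (cases "e \<in> J0") simp_all
        qed
        have "sum c J' + sum c J0 =
            (\<Sum>e\<in>E. (if e \<in> J' then c e else 0) + (if e \<in> J0 then c e else 0))"
          unfolding sum.distrib by (simp only: sum_if_mem[OF E(1) less.prems(1)] sum_if_mem[OF E(1) J0E])
        also have "\<dots> = (\<Sum>e\<in>E. (if e \<in> J1 then c e else 0) + (if e \<in> J2 then c e else 0))"
          by (simp only: eq)
        also have "\<dots> = sum c J1 + sum c J2"
          unfolding sum.distrib by (simp only: sum_if_mem[OF E(1) E12(1)] sum_if_mem[OF E(1) E12(2)])
        finally show ?thesis .
      qed
      have near2: "near s t J2" unfolding near_def on2 using E12(2) J0on st by blast
      have "e1 \<in> C" using Ccut unfolding B_def by blast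
      moreover have "e1 \<notin> J0" using avoid[OF J0] e12(4) by blast
      ultimately have "e1 \<in> J2 \<inter> cut S" using e12(4) unfolding J2_def by blast
      then have "sum c J2 \<noteq> m" using avoid[OF near2] by fast
      then have gt: "sum c J2 > m" using min[OF near2] by simp
      \<comment> \<open>Switching along the Eulerian set \<open>C\<close> keeps the parity of the
        weight, so the strict increase over \<open>m\<close> is at least two.\<close>
      have "even (sum c J2 + sum c J0)"
      proof -
        have "sum c J2 + sum c J0 = sum c C + 2 * sum c (J0 - C)"
        proof -
          have "sum c J0 = sum c (J0 - C) + sum c (J0 \<inter> C)"
            using fin[OF J0E] by (subst sum.union_disjoint[symmetric]) (auto intro: sum.cong)
          moreover have "sum c C = sum c (C - J0) + sum c (J0 \<inter> C)"
            using fin[OF CE] by (subst sum.union_disjoint[symmetric]) (auto intro: sum.cong)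
          moreover have "sum c J2 = sum c (J0 - C) + sum c (C - J0)"
            unfolding J2_def using fin[OF CE] fin[OF J0E] by (intro sum.union_disjoint) auto
          ultimately show ?thesis by simp
        qed
        then show ?thesis using even[OF CE Con] by simp
      qed
      then have evm: "even (sum c J2 + m)" using J0(2) by simp
      have "m + 2 \<le> p" if "even (p + m)" "p > m" for p using that by presburger
      from this[OF evm gt] have gt2: "sum c J2 \<ge> m + 2" .
      have "J1 \<inter> cut S = (J' \<inter> cut S) - B" "B \<subseteq> J' \<inter> cut S"
        unfolding J1_def using Ccut Dcut BD by blast+
      moreover have "card B = 2" using e12(3) by (simp add: B_def)
      ultimately have card1: "card (J' \<inter> cut S) = card (J1 \<inter> cut S) + 2"
        using card_Diff_subset[of B "J' \<inter> cut S"] card_mono[of "J' \<inter> cut S" B]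
          fin[OF less.prems(1)] by (simp add: B_def)
      have "sum c J + card (J1 \<inter> cut S) \<le> sum c J1 + 1"
        using less.hyps[of J1] card1 E12 on1 by simp
      then show ?thesis using swap gt2 J0(2) card1 by simp
    qed
  qed
  have "card (J \<inter> cut S) \<le> 1" using key[OF J refl] by simp
  \<comment> \<open>Since \<open>J0\<close> avoids the cut, \<open>J\<close> crosses it as often as
    \<open>sym_diff J J0\<close>, whose only odd node in \<open>S\<close> is
    \<open>t\<close>.\<close>
  moreover have "odd (card (J \<inter> cut S))"
  proof -
    have "odd_nodes (sym_diff J J0) = {s, t}"
      unfolding od[OF J J0E] J0on by auto
    then have "odd_nodes (sym_diff J J0) \<inter> S = {t}" using tS sS by simp
    moreover have "sym_diff J J0 \<inter> cut S = J \<inter> cut S" using avoid[OF J0] by blast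
    moreover have "odd (card (sym_diff J J0 \<inter> cut S)) \<longleftrightarrow>
        odd (card (odd_nodes (sym_diff J J0) \<inter> S))"
    proof (rule odd_card_cut)
      show "finite (sym_diff J J0)" using fin[OF J] fin[OF J0E] by simp
      show "card e = 2" if "e \<in> sym_diff J J0" for e using that E(2) J J0E by blast
    qed
    ultimately show ?thesis by simp
  qed
  ultimately have "card (J \<inter> cut S) = 1" by (cases "card (J \<inter> cut S)") auto
  then show ?thesis using that cpos key by blast
qed

text \<open>Lowering \<open>c\<close> by one on the reducing cut preserves optimality of
  \<open>J\<close>, and also the parity condition, since Eulerian sets cross a cut evenly. The left
  side drops by one and the right side by the value of \<open>x\<close> on the cut, which is at
  least one.\<close>

lemma optimal_join_weight_le_nat:
  fixes c :: "'v set \<Rightarrow> nat" and x :: "'v set \<Rightarrow> real"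
  assumes E: "finite E" "\<And>e. e \<in> E \<Longrightarrow> card e = 2" and J: "J \<subseteq> E"
    and even: "\<And>C. C \<subseteq> E \<Longrightarrow> odd_nodes C = {} \<Longrightarrow> even (sum c C)"
    and opt: "\<And>J'. J' \<subseteq> E \<Longrightarrow> odd_nodes J' = odd_nodes J \<Longrightarrow> sum c J \<le> sum c J'"
    and x0: "\<And>e. e \<in> E - J \<Longrightarrow> 0 \<le> x e"
    and xcut: "\<And>S. card (J \<inter> cut S) = 1 \<Longrightarrow> 1 \<le> sum x (E \<inter> cut S)"
  shows "real (sum c J) \<le> (\<Sum>e\<in>E. real (c e) * x e)"
  using even opt
proof (induction "sum c J" arbitrary: c rule: less_induct)
  case less
  have fin: "finite A" if "A \<subseteq> E" for A using that E(1) finite_subset by blast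
  show ?case
  proof (cases "sum c J = 0")
    case True
    \<comment> \<open>\<open>x\<close> may be negative on \<open>J\<close>, but the weights vanish
      there.\<close>
    then have "c e = 0" if "e \<in> J" for e using that fin[OF J] by simp
    then have "0 \<le> real (c e) * x e" if "e \<in> E" for e
      using that x0[of e] by (cases "e \<in> J") auto
    then show ?thesis unfolding True by (simp add: sum_nonneg)
  next
    case False
    then obtain S where S: "\<And>e. e \<in> E \<inter> cut S \<Longrightarrow> c e \<ge> 1" "card (J \<inter> cut S) = 1"
      and key: "\<And>J'. J' \<subseteq> E \<Longrightarrow> odd_nodes J' = odd_nodes J \<Longrightarrow>
        sum c J + card (J' \<inter> cut S) \<le> sum c J' + 1"
      using exists_reducing_cut[OF E J less.prems] by blast
    \<comment> \<open>Natural subtraction does not truncate on \<open>E\<close>, because the weights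
      on the cut are positive.\<close>
    define c' where "c' e = c e - (if e \<in> cut S then 1 else 0)" for e
    have c: "c e = c' e + (if e \<in> cut S then 1 else 0)" if "e \<in> E" for e
      using S(1)[of e] that by (simp add: c'_def)
    have sumc: "sum c A = sum c' A + card (A \<inter> cut S)" if "A \<subseteq> E" for A
    proof -
      have "sum c A = (\<Sum>e\<in>A. c' e + (if e \<in> cut S then 1 else 0))"
        using that c by (intro sum.cong) auto
      also have "\<dots> = sum c' A + card (A \<inter> cut S)"
        using fin[OF that] by (simp add: sum.distrib sum.If_cases)
      finally show ?thesis .
    qed
    have "real (sum c' J) \<le> (\<Sum>e\<in>E. real (c' e) * x e)"
    proof (rule less.hyps)
      show "sum c' J < sum c J" using sumc[OF J] S(2) by simp
      show "even (sum c' C)" if "C \<subseteq> E" "odd_nodes C = {}" for C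
      proof -
        have "even (card (C \<inter> cut S))"
          using odd_card_cut[OF fin[OF that(1)], of S] E(2) that by auto
        then show ?thesis using sumc[OF that(1)] less.prems(1)[OF that] by simp
      qed
      show "sum c' J \<le> sum c' J'" if "J' \<subseteq> E" "odd_nodes J' = odd_nodes J" for J'
        using key[OF that] sumc[OF that(1)] sumc[OF J] S(2) by simp
    qed
    moreover have "(\<Sum>e\<in>E. real (c e) * x e) =
        (\<Sum>e\<in>E. real (c' e) * x e) + sum x (E \<inter> cut S)"
    proof -
      have "(\<Sum>e\<in>E. real (c e) * x e) =
          (\<Sum>e\<in>E. real (c' e) * x e + (if e \<in> cut S then x e else 0))"
        using c by (intro sum.cong) (auto simp: algebra_simps)
      then show ?thesis by (simp add: sum.distrib sum.inter_restrict[OF E(1)])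
    qed
    ultimately show ?thesis using xcut[OF S(2)] sumc[OF J] S(2) by simp
  qed
qed

text \<open>Rounding the weights down on \<open>J\<close> and up elsewhere keeps \<open>J\<close> optimal.\<close>

lemma optimal_join_weight_le:
  fixes c x :: "'v set \<Rightarrow> real"
  assumes E: "finite E" "\<And>e. e \<in> E \<Longrightarrow> card e = 2" and J: "J \<subseteq> E"
    and c0: "\<And>e. e \<in> E \<Longrightarrow> 0 \<le> c e"
    and opt: "\<And>J'. J' \<subseteq> E \<Longrightarrow> odd_nodes J' = odd_nodes J \<Longrightarrow> sum c J \<le> sum c J'"
    and x0: "\<And>e. e \<in> E - J \<Longrightarrow> 0 \<le> x e"
    and xcut: "\<And>S. card (J \<inter> cut S) = 1 \<Longrightarrow> 1 \<le> sum x (E \<inter> cut S)"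
  shows "sum c J \<le> (\<Sum>e\<in>E. c e * x e)"
proof (rule ccontr)
  assume neg: "\<not> ?thesis"
  have fin: "finite A" if "A \<subseteq> E" for A using that E(1) finite_subset by blast
  \<comment> \<open>Rounding at scale \<open>2 * N\<close> moves each weight by at most 2, which
    costs at most \<open>2 * M\<close> in total; \<open>N\<close> is chosen to make the violation
    \<open>2 * N * d\<close> larger.\<close>
  define M where "M = (\<Sum>e\<in>E. \<bar>x e\<bar>) + real (card J)"
  define d where "d = sum c J - (\<Sum>e\<in>E. c e * x e)"
  have "d > 0" using neg by (simp add: d_def)
  then obtain N :: nat where N: "M < real N * d"
    using ex_less_of_nat_mult by blast
  \<comment> \<open>The factor 2 makes all weights even, so the parity condition on Eulerian sets
    holds trivially.\<close>
  define k where
    "k e = 2 * nat (if e \<in> J then \<lfloor>real N * c e\<rfloor> else \<lceil>real N * c e\<rceil>)" for e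
  have nonneg: "0 \<le> real N * c e" if "e \<in> E" for e using c0[OF that] by simp
  have kJ: "real (k e) \<le> 2 * real N * c e \<and> 2 * real N * c e - 2 \<le> real (k e)" if "e \<in> J" for e
    using that nonneg[of e] J unfolding k_def by (simp add: subset_iff) linarith
  have kE: "2 * real N * c e \<le> real (k e) \<and> real (k e) \<le> 2 * real N * c e + 2"
    if "e \<in> E - J" for e
    using that nonneg[of e] unfolding k_def by (simp add: le_nat_iff) linarith
  have "real (sum k J) \<le> (\<Sum>e\<in>E. real (k e) * x e)"
  proof (rule optimal_join_weight_le_nat[OF E J _ _ x0 xcut])
    show "even (sum k C)" for C unfolding k_def sum_distrib_left[symmetric] by simp
    show "sum k J \<le> sum k J'" if J': "J' \<subseteq> E" "odd_nodes J' = odd_nodes J" for J'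
    proof -
      have split: "sum h A = sum h (A - B) + sum h (A \<inter> B)" if "A \<subseteq> E"
        for h :: "'v set \<Rightarrow> real" and A B
        using fin[OF that] by (subst sum.union_disjoint[symmetric]) (auto intro: sum.cong)
      \<comment> \<open>Only the differences matter: weights on \<open>J - J'\<close> were rounded
        down, those on \<open>J' - J\<close> up.\<close>
      have "(\<Sum>e\<in>J - J'. real (k e)) \<le> (\<Sum>e\<in>J - J'. 2 * real N * c e)"
        using kJ by (intro sum_mono) auto
      also have "\<dots> = 2 * real N * sum c (J - J')" by (simp add: sum_distrib_left)
      also have "\<dots> \<le> 2 * real N * sum c (J' - J)"
        using opt[OF J'] split[OF J, of c J'] split[OF J'(1), of c J]
        by (intro mult_left_mono) (auto simp: Int_commute)
      also have "\<dots> = (\<Sum>e\<in>J' - J. 2 * real N * c e)" by (simp add: sum_distrib_left)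
      also have "\<dots> \<le> (\<Sum>e\<in>J' - J. real (k e))"
        using kE J'(1) by (intro sum_mono) auto
      finally have "(\<Sum>e\<in>J. real (k e)) \<le> (\<Sum>e\<in>J'. real (k e))"
        using split[OF J, of "\<lambda>e. real (k e)" J'] split[OF J'(1), of "\<lambda>e. real (k e)" J]
        by (simp add: Int_commute)
      then show ?thesis by (simp flip: of_nat_sum)
    qed
  qed
  moreover have "2 * real N * sum c J - 2 * real (card J) \<le> real (sum k J)"
  proof -
    have "(\<Sum>e\<in>J. 2 * real N * c e - 2) \<le> (\<Sum>e\<in>J. real (k e))"
      using kJ by (intro sum_mono) auto
    then show ?thesis by (simp add: sum_subtractf sum_distrib_left)
  qed
  moreover have "(\<Sum>e\<in>E. real (k e) * x e) \<le>
      2 * real N * (\<Sum>e\<in>E. c e * x e) + 2 * (\<Sum>e\<in>E. \<bar>x e\<bar>)"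
  proof -
    have "real (k e) * x e \<le> 2 * real N * (c e * x e) + 2 * \<bar>x e\<bar>" if "e \<in> E" for e
    proof -
      have "\<bar>real (k e) - 2 * real N * c e\<bar> \<le> 2"
        using kJ[of e] kE[of e] that by (cases "e \<in> J") auto
      then have "\<bar>(real (k e) - 2 * real N * c e) * x e\<bar> \<le> 2 * \<bar>x e\<bar>"
        unfolding abs_mult by (intro mult_right_mono) auto
      then show ?thesis by (simp add: algebra_simps abs_le_iff)
    qed
    then have "(\<Sum>e\<in>E. real (k e) * x e) \<le> (\<Sum>e\<in>E. 2 * real N * (c e * x e) + 2 * \<bar>x e\<bar>)"
      by (intro sum_mono) auto
    then show ?thesis by (simp add: sum.distrib sum_distrib_left)
  qed
  ultimately have "2 * (real N * d) \<le> 2 * M"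
    unfolding d_def M_def by (simp add: algebra_simps)
  then show False using N by simp
qed

section \<open>Flows\<close>

text \<open>Lower one offending arc as far as its capacity and the slack of the sets it enters
  permit. It then carries zero or enters a tight set, and no other arc becomes offending; induct on
  the number of offending arcs.\<close>

lemma exists_tight_capacities:
  fixes k :: "'v \<times> 'v \<Rightarrow> real"
  assumes V: "finite V" and k0: "\<And>a. 0 \<le> k a"
    and cuts: "\<And>S. S \<in> \<S> \<Longrightarrow> val \<le> sum k ((V - S) \<times> S)" and SV: "\<And>S. S \<in> \<S> \<Longrightarrow> S \<subseteq> V"
  obtains g where "\<And>a. 0 \<le> g a" "\<And>a. g a \<le> k a"
    "\<And>S. S \<in> \<S> \<Longrightarrow> val \<le> sum g ((V - S) \<times> S)"
    "\<And>a. a \<in> V \<times> V \<Longrightarrow> g a > 0 \<Longrightarrow> \<exists>S\<in>\<S>. a \<in> (V - S) \<times> S \<and> sum g ((V - S) \<times> S) = val"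
proof -
  define bad where "bad g = {a \<in> V \<times> V. g a > 0 \<and>
    \<not> (\<exists>S\<in>\<S>. a \<in> (V - S) \<times> S \<and> sum g ((V - S) \<times> S) = val)}" for g :: "'v \<times> 'v \<Rightarrow> real"
  have "\<exists>g. (\<forall>a. 0 \<le> g a) \<and> (\<forall>a. g a \<le> k a) \<and>
    (\<forall>S\<in>\<S>. val \<le> sum g ((V - S) \<times> S)) \<and> bad g = {}"
    using k0 cuts
  proof (induction "card (bad k)" arbitrary: k rule: less_induct)
    case less
    show ?case
    proof (cases "bad k = {}")
      case True
      then show ?thesis using less.prems by (intro exI[of _ k]) auto
    next
      case False
      then obtain a where a: "a \<in> bad k" by blast
      define X where "X = insert (k a)
        ((\<lambda>S. sum k ((V - S) \<times> S) - val) ` {S\<in>\<S>. a \<in> (V - S) \<times> S})"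
      have "finite \<S>" using SV V by (meson PowI finite_Pow_iff finite_subset subsetI)
      then have fX: "finite X" "X \<noteq> {}" by (simp_all add: X_def)
      define r where "r = Min X"
      have rX: "r \<in> X" using Min_in[OF fX] by (simp add: r_def)
      have rle: "r \<le> z" if "z \<in> X" for z using Min_le[OF fX(1) that] by (simp add: r_def)
      have Xpos: "0 < z" if zX: "z \<in> X" for z
      proof (cases "z = k a")
        case True
        then show ?thesis using a by (simp add: bad_def)
      next
        case False
        then obtain S where S: "S \<in> \<S>" "a \<in> (V - S) \<times> S" "z = sum k ((V - S) \<times> S) - val"
          using zX unfolding X_def by blast
        then have "sum k ((V - S) \<times> S) \<noteq> val" using a unfolding bad_def by blast
        then show ?thesis using less.prems(2)[OF S(1)] S(3) by simp
      qed
      have r0: "0 < r" using Xpos[OF rX] .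
      have rk: "r \<le> k a" by (rule rle) (simp add: X_def)
      define g where "g = k(a := k a - r)"
      have fin: "finite ((V - S) \<times> S)" if "S \<in> \<S>" for S
        using V SV[OF that] finite_subset by blast
      have sumg: "sum g ((V - S) \<times> S) = sum k ((V - S) \<times> S) - (if a \<in> (V - S) \<times> S then r else 0)"
        if "S \<in> \<S>" for S
      proof (cases "a \<in> (V - S) \<times> S")
        case True
        have "sum g ((V - S) \<times> S - {a}) = sum k ((V - S) \<times> S - {a})"
          by (intro sum.cong) (auto simp: g_def)
        then show ?thesis
          using sum.remove[OF fin[OF that] True, of g] sum.remove[OF fin[OF that] True, of k] True
          by (simp add: g_def)
      next
        case False
        have "sum g ((V - S) \<times> S) = sum k ((V - S) \<times> S)"
          using False by (intro sum.cong) (auto simp: g_def)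
        then show ?thesis using False by simp
      qed
      have g0: "0 \<le> g b" for b using less.prems(1)[of b] rk by (simp add: g_def)
      have gk: "g b \<le> k b" for b using r0 by (simp add: g_def)
      have gcut: "val \<le> sum g ((V - S) \<times> S)" if S: "S \<in> \<S>" for S
      proof (cases "a \<in> (V - S) \<times> S")
        case True
        then have "r \<le> sum k ((V - S) \<times> S) - val" using S by (intro rle) (unfold X_def, blast)
        then show ?thesis using sumg[OF S] True by simp
      next
        case False
        then show ?thesis using sumg[OF S] less.prems(2)[OF S] by simp
      qed
      have "a \<notin> bad g"
      proof (cases "r = k a")
        case True
        then show ?thesis by (simp add: bad_def g_def)
      next
        case False
        then obtain S where S: "S \<in> \<S>" "a \<in> (V - S) \<times> S" "r = sum k ((V - S) \<times> S) - val"
          using rX unfolding X_def by blast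
        then have "sum g ((V - S) \<times> S) = val" using sumg[OF S(1)] by simp
        then show ?thesis using S(1,2) unfolding bad_def by blast
      qed
      \<comment> \<open>The arc \<open>a\<close> enters no set that was tight, so tight sets stay
        tight.\<close>
      moreover have "b \<in> bad k" if b: "b \<in> bad g" "b \<noteq> a" for b
      proof -
        have "k b > 0" "b \<in> V \<times> V" using b by (auto simp: bad_def g_def)
        moreover have False if S: "S \<in> \<S>" "b \<in> (V - S) \<times> S" "sum k ((V - S) \<times> S) = val" for S
        proof -
          have "a \<notin> (V - S) \<times> S" using a S unfolding bad_def by blast
          then have "sum g ((V - S) \<times> S) = val" using sumg[OF S(1)] S(3) by simp
          then show False using b(1) S(1,2) unfolding bad_def by blast
        qed
        ultimately show ?thesis unfolding bad_def by blast
      qed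
      ultimately have "bad g \<subset> bad k" using a by blast
      moreover have "finite (bad k)" using V by (simp add: bad_def)
      ultimately have "card (bad g) < card (bad k)" by (rule psubset_card_mono[rotated])
      then obtain g' where "\<forall>a. 0 \<le> g' a" "\<forall>a. g' a \<le> g a"
        "\<forall>S\<in>\<S>. val \<le> sum g' ((V - S) \<times> S)" "bad g' = {}"
        using less.hyps[of g] g0 gcut by auto
      then show ?thesis using gk order_trans by (intro exI[of _ g']) blast
    qed
  qed
  then show ?thesis using that unfolding bad_def by blast
qed

text \<open>Lower the capacities until every arc with positive capacity enters a tight set. Tight sets are
  closed under union, so all arcs leaving \<open>u\<close> enter the largest tight set \<open>B\<close> avoiding \<open>u\<close>, and the cut
  condition for \<open>B \<union> {u}\<close> bounds the outflow of \<open>u\<close> by its inflow: the capacities are the flow.\<close>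

lemma exists_flow_of_cuts:
  fixes k :: "'v \<times> 'v \<Rightarrow> real"
  assumes V: "finite V" "t \<in> V" and k0: "\<And>a. 0 \<le> k a"
    and cuts: "\<And>S. S \<subseteq> V \<Longrightarrow> t \<in> S \<Longrightarrow> s \<notin> S \<Longrightarrow> val \<le> sum k ((V - S) \<times> S)"
  obtains g where "\<And>a. 0 \<le> g a" "\<And>a. g a \<le> k a"
    "\<And>u. u \<in> V - {s} \<Longrightarrow> (if u = t then val else 0) \<le> sum g (V \<times> {u}) - sum g ({u} \<times> V)"
proof -
  define \<S> where "\<S> = {S. S \<subseteq> V \<and> t \<in> S \<and> s \<notin> S}"
  have "\<And>S. S \<in> \<S> \<Longrightarrow> val \<le> sum k ((V - S) \<times> S)" "\<And>S. S \<in> \<S> \<Longrightarrow> S \<subseteq> V"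
    using cuts by (auto simp: \<S>_def)
  then obtain g where g0: "\<And>a. 0 \<le> g a" and gk: "\<And>a. g a \<le> k a"
    and gcut: "\<And>S. S \<in> \<S> \<Longrightarrow> val \<le> sum g ((V - S) \<times> S)"
    and tight: "\<And>a. a \<in> V \<times> V \<Longrightarrow> g a > 0 \<Longrightarrow>
      \<exists>S\<in>\<S>. a \<in> (V - S) \<times> S \<and> sum g ((V - S) \<times> S) = val"
    using exists_tight_capacities[of V k \<S> val] V(1) k0 by metis
  define \<T> where "\<T> = {S\<in>\<S>. sum g ((V - S) \<times> S) = val}"
  have finT: "finite \<T>" using V(1) by (simp add: \<T>_def \<S>_def)
  \<comment> \<open>Uncrossing: the weight entering a set is submodular, and union and intersection
    both satisfy the cut condition, so both must be tight.\<close>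
  have union: "A \<union> B \<in> \<T>" if A: "A \<in> \<T>" and B: "B \<in> \<T>" for A B
  proof -
    have AB: "A \<subseteq> V" "B \<subseteq> V" "A \<union> B \<in> \<S>" "A \<inter> B \<in> \<S>" using A B by (auto simp: \<T>_def \<S>_def)
    have expand: "sum g ((V - S) \<times> S) = (\<Sum>a\<in>V \<times> V. if a \<in> (V - S) \<times> S then g a else 0)"
      if "S \<subseteq> V" for S
      using that V(1) by (intro sum_if_mem) auto
    have "(if a \<in> (V - (A \<union> B)) \<times> (A \<union> B) then g a else 0) +
        (if a \<in> (V - (A \<inter> B)) \<times> (A \<inter> B) then g a else 0)
        \<le> (if a \<in> (V - A) \<times> A then g a else 0) + (if a \<in> (V - B) \<times> B then g a else 0)" for a
      using g0[of a] by (cases a) simp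
    then have "sum g ((V - (A \<union> B)) \<times> (A \<union> B)) + sum g ((V - (A \<inter> B)) \<times> (A \<inter> B))
        \<le> sum g ((V - A) \<times> A) + sum g ((V - B) \<times> B)"
      using AB(1,2)
      by (simp only: expand Un_least le_infI1 sum.distrib[symmetric]) (intro sum_mono)
    then have "sum g ((V - (A \<union> B)) \<times> (A \<union> B)) = val"
      using gcut[OF AB(3)] gcut[OF AB(4)] A B by (simp add: \<T>_def)
    then show ?thesis using AB(3) by (simp add: \<T>_def)
  qed
  have split: "sum g (A \<union> B) = sum g A + sum g B"
    if "A \<subseteq> V \<times> V" "B \<subseteq> V \<times> V" "A \<inter> B = {}" for A B
    using that finite_subset[OF _ finite_cartesian_product[OF V(1) V(1)]]
    by (intro sum.union_disjoint) auto
  have "(if u = t then val else 0) \<le> sum g (V \<times> {u}) - sum g ({u} \<times> V)"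
    if u: "u \<in> V - {s}" for u
  proof (cases "\<exists>w\<in>V. g (u, w) > 0")
    case False
    then have "g (u, w) = 0" if "w \<in> V" for w using that g0[of "(u, w)"] by force
    then have out: "sum g ({u} \<times> V) = 0" by (intro sum.neutral) auto
    show ?thesis
    proof (cases "u = t")
      case True
      have "val \<le> sum g ((V - {t}) \<times> {t})" using u True V by (intro gcut) (auto simp: \<S>_def)
      also have "\<dots> \<le> sum g (V \<times> {t})" using V(1) g0 by (intro sum_mono2) auto
      finally show ?thesis using True out by simp
    next
      case False
      then show ?thesis using out g0 by (simp add: sum_nonneg)
    qed
  next
    case True
    define \<U> where "\<U> = {S\<in>\<T>. u \<notin> S}"
    have out_tight: "\<exists>S\<in>\<U>. w \<in> S" if "w \<in> V" "g (u, w) > 0" for w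
      using tight[of "(u, w)"] that u by (auto simp: \<U>_def \<T>_def)
    then have "finite \<U>" "\<U> \<noteq> {}" using True finT by (auto simp: \<U>_def)
    then obtain B where B: "B \<in> \<U>" "\<And>S. S \<in> \<U> \<Longrightarrow> B \<subseteq> S \<Longrightarrow> B = S"
      using finite_has_maximal[of \<U>] by auto
    have SB: "S \<subseteq> B" if "S \<in> \<U>" for S
    proof -
      have "B \<union> S \<in> \<U>" using that B(1) union by (auto simp: \<U>_def)
      then show ?thesis using B(2)[of "B \<union> S"] by blast
    qed
    have BV: "B \<subseteq> V" "t \<in> B" "s \<notin> B" "u \<notin> B" and Bval: "sum g ((V - B) \<times> B) = val"
      using B(1) by (auto simp: \<U>_def \<T>_def \<S>_def)
    have ut: "u \<noteq> t" using BV by blast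
    define R where "R = V - B - {u}"
    have "sum g ({u} \<times> V) = sum g ({u} \<times> B)"
    proof (rule sum.mono_neutral_right)
      show "finite ({u} \<times> V)" using V by simp
      show "{u} \<times> B \<subseteq> {u} \<times> V" using BV by auto
      show "\<forall>a\<in>{u} \<times> V - {u} \<times> B. g a = 0"
      proof
        fix a assume a: "a \<in> {u} \<times> V - {u} \<times> B"
        then obtain w where w: "a = (u, w)" "w \<in> V" "w \<notin> B" by auto
        show "g a = 0"
          using out_tight[OF w(2)] SB w g0[of a] by (cases "g a > 0") auto
      qed
    qed
    moreover have "sum g ((V - B) \<times> B) = sum g (R \<times> B) + sum g ({u} \<times> B)"
    proof -
      have "(V - B) \<times> B = R \<times> B \<union> {u} \<times> B" using u BV by (auto simp: R_def)
      then show ?thesis using BV u by (simp only:) (intro split, auto simp: R_def)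
    qed
    moreover have "sum g ((V - (B \<union> {u})) \<times> (B \<union> {u})) = sum g (R \<times> B) + sum g (R \<times> {u})"
    proof -
      have "(V - (B \<union> {u})) \<times> (B \<union> {u}) = R \<times> B \<union> R \<times> {u}" by (auto simp: R_def)
      then show ?thesis using BV u by (simp only:) (intro split, auto simp: R_def)
    qed
    \<comment> \<open>Compared with the tight cut at \<open>B\<close>, this says that the flow from
      \<open>u\<close> into \<open>B\<close>, which is all the outflow of \<open>u\<close>, is at
      most the flow from \<open>R\<close> into \<open>u\<close>.\<close>
    moreover have "val \<le> sum g ((V - (B \<union> {u})) \<times> (B \<union> {u}))"
      using BV u by (intro gcut) (auto simp: \<S>_def)
    moreover have "sum g (R \<times> {u}) \<le> sum g (V \<times> {u})"
      using V g0 by (intro sum_mono2) (auto simp: R_def)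
    ultimately show ?thesis using Bval ut by simp
  qed
  then show ?thesis using that g0 gk by blast
qed

section \<open>Facets and extension complexity\<close>

text \<open>Elimination: a vector \<open>g p\<close> that is nonzero in coordinate \<open>d\<close>
  clears that coordinate from the others, leaving one vector and one coordinate less;
  \<open>q\<close> is the coefficient of \<open>g p\<close> that undoes this.\<close>

lemma exists_linear_dependence:
  fixes g :: "'b \<Rightarrow> 'i \<Rightarrow> real"
  assumes "finite D" "finite B" "card D < card B"
  shows "\<exists>u. (\<exists>b\<in>B. u b \<noteq> 0) \<and> (\<forall>i\<in>D. (\<Sum>b\<in>B. u b * g b i) = 0)"
  using assms
proof (induction D arbitrary: B g rule: finite_induct)
  case empty
  then have "B \<noteq> {}" by auto
  then show ?case by (intro exI[of _ "\<lambda>_. 1"]) auto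
next
  case (insert d D)
  show ?case
  proof (cases "\<forall>b\<in>B. g b d = 0")
    case True
    have "card D < card B" using insert by simp
    then obtain u where "\<exists>b\<in>B. u b \<noteq> 0" "\<forall>i\<in>D. (\<Sum>b\<in>B. u b * g b i) = 0"
      using insert.IH[OF insert.prems(1), of g] by blast
    then show ?thesis using True by (intro exI[of _ u]) auto
  next
    case False
    then obtain p where p: "p \<in> B" "g p d \<noteq> 0" by blast
    define h where "h b i = g b i - g b d / g p d * g p i" for b i
    have "card D < card (B - {p})" using insert p by simp
    then obtain u where u: "\<exists>b\<in>B - {p}. u b \<noteq> 0" "\<forall>i\<in>D. (\<Sum>b\<in>B - {p}. u b * h b i) = 0"
      using insert.IH[of "B - {p}" h] insert.prems(1) by auto
    define q where "q = - (\<Sum>b\<in>B - {p}. u b * (g b d / g p d))"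
    define v where "v = u(p := q)"
    have v: "(\<Sum>b\<in>B. v b * g b i) = (\<Sum>b\<in>B - {p}. u b * h b i)" for i
    proof -
      have "(\<Sum>b\<in>B - {p}. v b * g b i) = (\<Sum>b\<in>B - {p}. u b * g b i)"
        by (intro sum.cong) (auto simp: v_def)
      then have "(\<Sum>b\<in>B. v b * g b i) = q * g p i + (\<Sum>b\<in>B - {p}. u b * g b i)"
        using sum.remove[OF insert.prems(1) p(1), of "\<lambda>b. v b * g b i"] by (simp add: v_def)
      also have "\<dots> = (\<Sum>b\<in>B - {p}. u b * h b i)"
        by (simp add: q_def h_def sum_distrib_right sum_subtractf right_diff_distrib mult.assoc)
      finally show ?thesis .
    qed
    have "(\<Sum>b\<in>B. v b * g b i) = 0" if "i \<in> insert d D" for i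
    proof (cases "i = d")
      case True
      then show ?thesis using v[of d] p by (simp add: h_def)
    next
      case False
      then show ?thesis using v[of i] u(2) that by simp
    qed
    moreover have "\<exists>b\<in>B. v b \<noteq> 0" using u(1) by (auto simp: v_def)
    ultimately show ?thesis by blast
  qed
qed

lemma aff_indep_card_le:
  assumes D: "finite D" and B: "B \<subseteq> fspace D" "aff_indep B"
  shows "card B \<le> card D + 1"
proof (rule ccontr)
  assume big: "\<not> ?thesis"
  \<comment> \<open>The extra coordinate \<open>None\<close>, constantly 1, turns affine into linear
    dependence: it encodes that the coefficients sum to 0.\<close>
  define D' where "D' = insert None (Some ` D)"
  have "card D' = card D + 1" using D by (simp add: D'_def card_image image_iff)
  then have "card D' < card B" using big by simp
  moreover have fB: "finite B" using B by (simp add: aff_indep_def)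
  moreover have "finite D'" using D by (simp add: D'_def)
  ultimately obtain u where u: "\<exists>b\<in>B. u b \<noteq> 0"
    "\<forall>i\<in>D'. (\<Sum>b\<in>B. u b * (case i of None \<Rightarrow> 1 | Some j \<Rightarrow> b j)) = 0"
    using exists_linear_dependence[of D' B "\<lambda>b i. case i of None \<Rightarrow> 1 | Some j \<Rightarrow> b j"] by blast
  have "sum u B = 0" using u(2) by (auto simp: D'_def)
  moreover have "(\<Sum>b\<in>B. u b * b i) = 0" for i
  proof (cases "i \<in> D")
    case True
    then show ?thesis using u(2) by (auto simp: D'_def)
  next
    case False
    then have "b i = 0" if "b \<in> B" for b using that B(1) by (auto simp: fspace_def)
    then show ?thesis by (intro sum.neutral) auto
  qed
  ultimately have "\<forall>y\<in>B. u y = 0" using B(2) by (simp add: aff_indep_def)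
  then show False using u(1) by blast
qed

text \<open>The \<open>Max\<close> in \<open>adim\<close> behaves as a maximum because its set is
  finite by \<open>aff_indep_card_le\<close> and contains the cardinality of the empty set.\<close>

lemma adim_bounds:
  assumes D: "finite D" and S: "S \<subseteq> fspace D"
  shows "\<And>B. B \<subseteq> S \<Longrightarrow> aff_indep B \<Longrightarrow> int (card B) - 1 \<le> adim S"
    and "\<exists>B\<subseteq>S. aff_indep B \<and> int (card B) - 1 = adim S"
proof -
  let ?X = "{int (card B) | B. B \<subseteq> S \<and> aff_indep B}"
  have "?X \<subseteq> int ` {..card D + 1}" using aff_indep_card_le[OF D] S by fastforce
  then have fin: "finite ?X" using finite_subset by blast
  have ne: "?X \<noteq> {}" by (auto simp: aff_indep_def intro!: exI[of _ "{}"])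
  show "int (card B) - 1 \<le> adim S" if "B \<subseteq> S" "aff_indep B" for B
    unfolding adim_def using that by (intro diff_right_mono Max_ge[OF fin]) auto
  have "Max ?X \<in> ?X" by (rule Max_in[OF fin ne])
  then show "\<exists>B\<subseteq>S. aff_indep B \<and> int (card B) - 1 = adim S" unfolding adim_def by auto
qed

text \<open>Applying the functional \<open>a\<close> to an affine dependence shows that the
  coefficient of the point off the hyperplane is zero.\<close>

lemma aff_indep_insert:
  assumes B: "aff_indep B" "\<And>y. y \<in> B \<Longrightarrow> dotp D a y = \<beta>" and z: "dotp D a z \<noteq> \<beta>"
  shows "z \<notin> B" "aff_indep (insert z B)"
proof -
  show zB: "z \<notin> B" using B z by blast
  have fB: "finite B" using B by (simp add: aff_indep_def)
  show "aff_indep (insert z B)"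
    unfolding aff_indep_def
  proof (intro conjI allI impI)
    show "finite (insert z B)" using fB by simp
    fix u assume u: "sum u (insert z B) = 0 \<and> (\<forall>i. (\<Sum>y\<in>insert z B. u y * y i) = 0)"
    have s: "sum u B = - u z" using u fB zB by simp
    have c: "u z * z i + (\<Sum>y\<in>B. u y * y i) = 0" for i using u fB zB by simp
    have "u z * dotp D a z + (\<Sum>y\<in>B. u y * dotp D a y) =
        (\<Sum>i\<in>D. a i * (u z * z i + (\<Sum>y\<in>B. u y * y i)))"
      unfolding dotp_def distrib_left sum.distrib sum_distrib_left
      by (subst sum.swap) (simp add: mult.left_commute)
    also have "\<dots> = 0" using c by simp
    finally have "u z * dotp D a z + sum u B * \<beta> = 0"
      using B(2) by (simp add: sum_distrib_right)
    then have "u z * (dotp D a z - \<beta>) = 0" using s by (simp add: algebra_simps)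
    then have uz: "u z = 0" using z by simp
    then have "\<forall>y\<in>B. u y = 0" using B(1) s c by (simp add: aff_indep_def)
    then show "\<forall>y\<in>insert z B. u y = 0" using uz by simp
  qed
qed

section \<open>Facets come from defining inequalities\<close>

lemma dotp_combination:
  "dotp D a (\<lambda>i. r * p i + q * y i) = r * dotp D a p + q * dotp D a y"
  unfolding dotp_def by (simp add: sum_distrib_left sum.distrib algebra_simps)

lemma exists_small_step:
  fixes d h :: "'a \<Rightarrow> real"
  assumes "finite N" "\<And>j. j \<in> N \<Longrightarrow> 0 < h j"
  shows "\<exists>\<epsilon>>0. \<forall>j\<in>N. \<epsilon> * d j \<le> h j"
  using assms
proof (induction N rule: finite_induct)
  case empty
  then show ?case by (intro exI[of _ 1]) simp
next
  case (insert j N)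
  then obtain \<epsilon> where \<epsilon>: "\<epsilon> > 0" "\<forall>j\<in>N. \<epsilon> * d j \<le> h j" by auto
  define \<delta> where "\<delta> = min \<epsilon> (h j / (\<bar>d j\<bar> + 1))"
  have hj: "0 < h j" using insert by simp
  have "0 < \<delta>" using \<epsilon>(1) hj by (simp add: \<delta>_def)
  moreover have "\<delta> * d i \<le> h i" if "i \<in> insert j N" for i
  proof (cases "i = j")
    case True
    have "\<delta> * d j \<le> \<delta> * (\<bar>d j\<bar> + 1)" using \<open>0 < \<delta>\<close> by (intro mult_left_mono) auto
    also have "\<dots> \<le> h j / (\<bar>d j\<bar> + 1) * (\<bar>d j\<bar> + 1)"
      by (intro mult_right_mono) (auto simp: \<delta>_def)
    also have "\<dots> = h j" by (simp add: add_nonneg_eq_0_iff)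
    finally show ?thesis using True by simp
  next
    case False
    then have i: "\<epsilon> * d i \<le> h i" "0 < h i" using \<epsilon>(2) that insert.prems by auto
    show ?thesis
    proof (cases "0 \<le> d i")
      case True
      then have "\<delta> * d i \<le> \<epsilon> * d i" by (intro mult_right_mono) (simp_all add: \<delta>_def)
      then show ?thesis using i(1) by simp
    next
      case False
      then have "\<delta> * d i \<le> 0" using \<open>0 < \<delta>\<close> by (intro mult_nonneg_nonpos) simp_all
      then show ?thesis using i(2) by simp
    qed
  qed
  ultimately show ?case by blast
qed

text \<open>A point \<open>p\<close> of \<open>F\<close> that is strict in every constraint not
  tight on all of \<open>F\<close>, and a point \<open>q\<close> of \<open>Q - F\<close>, yield a
  constraint tight on \<open>F\<close> but not at \<open>q\<close>. Its face contains
  \<open>F\<close>; were it larger, the dimension of \<open>Q\<close> would exceed that of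
  \<open>F\<close> by at least two.\<close>

lemma facet_in_constraint:
  assumes D: "finite D" and Q: "Q = {x \<in> fspace D. \<forall>j<k. dotp D (A j) x \<le> b j}"
    and F: "facet_in D F Q"
  shows "\<exists>j<(k::nat). F = {y\<in>Q. dotp D (A j) y = b j}"
proof -
  obtain a \<beta> where valid: "\<And>y. y \<in> Q \<Longrightarrow> dotp D a y \<le> \<beta>" and Fa: "F = {y\<in>Q. dotp D a y = \<beta>}"
    using F unfolding facet_in_def face_in_def by blast
  have Fne: "F \<noteq> {}" and dim: "adim F = adim Q - 1" using F by (auto simp: facet_in_def)
  have FQ: "F \<subseteq> Q" using Fa by blast
  have QD: "Q \<subseteq> fspace D" using Q by blast
  have FD: "F \<subseteq> fspace D" using FQ QD by blast
  obtain q where q: "q \<in> Q" "q \<notin> F" using FQ dim by (cases "F = Q") auto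
  define N where "N = {j. j < k \<and> (\<exists>y\<in>F. dotp D (A j) y < b j)}"
  have fN: "finite N" by (simp add: N_def)
  have comb: "(\<lambda>i. r * p i + (1 - r) * y i) \<in> fspace D" if "p \<in> Q" "y \<in> Q" for p y r
  proof -
    have "p \<in> fspace D" "y \<in> fspace D" using that QD by blast+
    then show ?thesis by (simp add: fspace_def)
  qed
  have mid: "(\<lambda>i. 1/2 * p i + (1 - 1/2) * y i) \<in> F" if "p \<in> F" "y \<in> F" for p y
  proof -
    have pyQ: "p \<in> Q" "y \<in> Q" using that FQ by auto
    have "1/2 * dotp D (A j) p + (1 - 1/2) * dotp D (A j) y \<le> b j" if "j < k" for j
    proof -
      have "dotp D (A j) p \<le> b j" "dotp D (A j) y \<le> b j" using pyQ that unfolding Q by simp_all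
      then show ?thesis by simp
    qed
    then have "(\<lambda>i. 1/2 * p i + (1 - 1/2) * y i) \<in> Q"
      using comb[OF pyQ, of "1/2"] unfolding Q mem_Collect_eq dotp_combination by blast
    moreover have "dotp D a p = \<beta>" "dotp D a y = \<beta>" using that Fa by auto
    ultimately show ?thesis unfolding Fa mem_Collect_eq dotp_combination by simp
  qed
  \<comment> \<open>A midpoint is strict wherever one of its ends is, so strictness is collected one
    constraint at a time.\<close>
  have "\<exists>p\<in>F. \<forall>j\<in>M. dotp D (A j) p < b j" if "finite M" "M \<subseteq> N" for M
    using that
  proof (induction M rule: finite_induct)
    case empty
    then show ?case using Fne by auto
  next
    case (insert j M)
    then obtain p where p: "p \<in> F" "\<forall>j\<in>M. dotp D (A j) p < b j" by auto
    obtain y where y: "y \<in> F" "dotp D (A j) y < b j" using insert.prems by (auto simp: N_def)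
    have le: "dotp D (A i) p \<le> b i" "dotp D (A i) y \<le> b i" if "i \<in> insert j M" for i
    proof -
      have "i < k" using that insert.prems by (auto simp: N_def)
      moreover have "p \<in> Q" "y \<in> Q" using p(1) y(1) FQ by blast+
      ultimately show "dotp D (A i) p \<le> b i" "dotp D (A i) y \<le> b i" unfolding Q by simp_all
    qed
    show ?case
      using mid[OF p(1) y(1)]
    proof (rule bexI[rotated])
      show "\<forall>i\<in>insert j M. dotp D (A i) (\<lambda>i. 1/2 * p i + (1 - 1/2) * y i) < b i"
      proof
        fix i assume i: "i \<in> insert j M"
        then have "dotp D (A i) p < b i \<or> dotp D (A i) y < b i" using p(2) y(2) by blast
        then show "dotp D (A i) (\<lambda>i. 1/2 * p i + (1 - 1/2) * y i) < b i"
          unfolding dotp_combination using le[OF i] by (elim disjE) simp_all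
      qed
    qed
  qed
  from this[OF fN] obtain p where p: "p \<in> F" "\<And>j. j \<in> N \<Longrightarrow> dotp D (A j) p < b j" by auto
  have pQ: "p \<in> Q" using p FQ by blast
  obtain j where j: "j < k" "j \<notin> N" "dotp D (A j) q \<noteq> b j"
  proof (rule ccontr)
    assume "\<not> thesis"
    then have "\<forall>j. j < k \<longrightarrow> j \<notin> N \<longrightarrow> dotp D (A j) q = b j" using that by blast
    then have no: "dotp D (A j) q = b j" if "j < k" "j \<notin> N" for j using that by blast
    obtain \<epsilon> where \<epsilon>: "\<epsilon> > 0"
      "\<forall>j\<in>N. \<epsilon> * (dotp D (A j) p - dotp D (A j) q) \<le> b j - dotp D (A j) p"
      using exists_small_step[OF fN, of "\<lambda>j. b j - dotp D (A j) p"
        "\<lambda>j. dotp D (A j) p - dotp D (A j) q"] p(2) by auto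
    \<comment> \<open>If \<open>q\<close> satisfies with equality every constraint tight on
      \<open>F\<close>, the segment from \<open>q\<close> to \<open>p\<close> can be prolonged a
      little beyond \<open>p\<close> inside \<open>Q\<close>, where it violates the inequality
      defining \<open>F\<close>.\<close>
    define r where "r = (\<lambda>i. (1 + \<epsilon>) * p i + (1 - (1 + \<epsilon>)) * q i)"
    have "dotp D (A j) r \<le> b j" if "j < k" for j
    proof (cases "j \<in> N")
      case True
      then show ?thesis using \<epsilon>(2) unfolding r_def dotp_combination by (auto simp: algebra_simps)
    next
      case False
      have "dotp D (A j) p \<le> b j" using pQ that unfolding Q by simp
      moreover have "\<not> dotp D (A j) p < b j" using False that p(1) by (auto simp: N_def)
      ultimately have "dotp D (A j) p = b j" by simp
      then show ?thesis using no[OF that False] unfolding r_def dotp_combination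
        by (simp add: algebra_simps)
    qed
    then have "r \<in> Q" using comb[OF pQ q(1), of "1 + \<epsilon>"] unfolding Q r_def by simp
    then have "dotp D a r \<le> \<beta>" by (rule valid)
    moreover have "dotp D a p = \<beta>" using p Fa by blast
    moreover have "dotp D a q \<noteq> \<beta>" using q Fa by blast
    then have "dotp D a q < \<beta>" using valid[OF q(1)] by simp
    ultimately have "\<epsilon> * (\<beta> - dotp D a q) \<le> 0"
      unfolding r_def dotp_combination by (simp add: algebra_simps)
    then show False using \<epsilon>(1) \<open>dotp D a q < \<beta>\<close> by (simp add: mult_le_0_iff)
  qed
  have sub: "dotp D (A j) y = b j" if "y \<in> F" for y
  proof -
    have "y \<in> Q" using that FQ by blast
    then have "dotp D (A j) y \<le> b j" using j(1) unfolding Q by simp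
    moreover have "\<not> dotp D (A j) y < b j" using that j(1,2) unfolding N_def by blast
    ultimately show ?thesis by simp
  qed
  have "F = {y\<in>Q. dotp D (A j) y = b j}"
  proof (rule ccontr)
    \<comment> \<open>\<open>z\<close> is off the hyperplane of \<open>F\<close>, and
      \<open>q\<close> is off that of constraint \<open>j\<close>, so an affinely independent subset
      of \<open>F\<close> of maximal size grows by two points.\<close>
    assume "F \<noteq> {y\<in>Q. dotp D (A j) y = b j}"
    then obtain z where z: "z \<in> Q" "dotp D (A j) z = b j" "z \<notin> F" using sub FQ by blast
    obtain B where B: "B \<subseteq> F" "aff_indep B" "int (card B) - 1 = adim F"
      using adim_bounds(2)[OF D FD] by blast
    have 1: "z \<notin> B" "aff_indep (insert z B)"
      using aff_indep_insert[OF B(2), of D a \<beta> z] B(1) z Fa by auto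
    have 2: "q \<notin> insert z B" "aff_indep (insert q (insert z B))"
      using aff_indep_insert[OF 1(2), of D "A j" "b j" q] B(1) z j(3) sub by auto
    have "int (card (insert q (insert z B))) - 1 \<le> adim Q"
      using adim_bounds(1)[OF D QD _ 2(2)] B(1) FQ z q by auto
    moreover have "finite B" using B by (simp add: aff_indep_def)
    ultimately show False using 1(1) 2(1) B(3) dim by simp
  qed
  then show ?thesis using j(1) by blast
qed

text \<open>The polyhedron upstairs has at most one facet per inequality by
  \<open>facet_in_constraint\<close>, so it bounds the \<open>LEAST\<close>. Arbitrary finite index
  sets are transported to numbers by bijections.\<close>

lemma xc_le:
  fixes A :: "'k \<Rightarrow> 'i \<Rightarrow> real" and I :: "'i set"
  assumes I: "finite I" and K: "finite K"
    and P: "P = {\<lambda>e. if e \<in> D then \<Sum>i\<in>I. M e i * y i else 0 | y. \<forall>k\<in>K. (\<Sum>i\<in>I. A k i * y i) \<le> b k}"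
  shows "xc D P \<le> card K"
proof -
  define m where "m = card I"
  obtain h where h: "bij_betw h {..<m} I"
    using ex_bij_betw_nat_finite[OF I] by (auto simp: m_def atLeast0LessThan)
  obtain l where l: "bij_betw l {..<card K} K"
    using ex_bij_betw_nat_finite[OF K] by (auto simp: atLeast0LessThan)
  define A' where "A' j i = A (l j) (h i)" for j i
  define Q where "Q = {x \<in> fspace {..<m}. \<forall>j<card K. dotp {..<m} (A' j) x \<le> b (l j)}"
  have reindex: "(\<Sum>i\<in>I. f i) = (\<Sum>i<m. f (h i))" for f :: "'i \<Rightarrow> real"
    using sum.reindex_bij_betw[OF h, of f] by simp
  have lK: "l ` {..<card K} = K" using l by (simp add: bij_betw_def)
  have poly: "polyhedron_in {..<m} Q" 
    unfolding polyhedron_in_def Q_def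
    by (intro conjI exI[of _ "card K"] exI[of _ A'] exI[of _ "\<lambda>j. b (l j)"]) simp_all
  have "P = lin_map D m (\<lambda>e i. M e (h i)) ` Q"
  proof (intro equalityI subsetI)
    fix x assume "x \<in> P"
    then obtain y where y: "\<forall>k\<in>K. (\<Sum>i\<in>I. A k i * y i) \<le> b k"
      "x = (\<lambda>e. if e \<in> D then \<Sum>i\<in>I. M e i * y i else 0)" using P by blast
    define z where "z i = (if i < m then y (h i) else 0)" for i
    have "dotp {..<m} (A' j) z \<le> b (l j)" if "j < card K" for j
    proof -
      have "l j \<in> K" using lK that by blast
      then have "(\<Sum>i\<in>I. A (l j) i * y i) \<le> b (l j)" using y(1) by blast
      then show ?thesis by (simp add: reindex dotp_def A'_def z_def)
    qed
    then have "z \<in> Q" by (simp add: Q_def fspace_def z_def)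
    moreover have "x = lin_map D m (\<lambda>e i. M e (h i)) z"
      unfolding y(2) lin_map_def by (simp add: reindex z_def cong: if_cong)
    ultimately show "x \<in> lin_map D m (\<lambda>e i. M e (h i)) ` Q" by blast
  next
    fix x assume "x \<in> lin_map D m (\<lambda>e i. M e (h i)) ` Q"
    then obtain z where z: "z \<in> Q" "x = lin_map D m (\<lambda>e i. M e (h i)) z" by blast
    define y where "y i = z (inv_into {..<m} h i)" for i
    have yh: "y (h i) = z i" if "i < m" for i
      using h that by (simp add: y_def bij_betw_def)
    have "(\<Sum>i\<in>I. A k i * y i) \<le> b k" if "k \<in> K" for k
    proof -
      have "k \<in> l ` {..<card K}" unfolding lK by (rule that)
      then obtain j where j: "j < card K" "l j = k" by auto
      have "dotp {..<m} (A' j) z \<le> b (l j)" using z(1) j(1) by (simp add: Q_def)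
      then show ?thesis using j by (simp add: reindex dotp_def A'_def yh)
    qed
    moreover have "x = (\<lambda>e. if e \<in> D then \<Sum>i\<in>I. M e i * y i else 0)"
      unfolding z(2) lin_map_def by (simp add: reindex yh cong: if_cong)
    ultimately show "x \<in> P" unfolding P by blast
  qed
  then have "xc D P \<le> card {F. facet_in {..<m} F Q}"
    unfolding xc_def using poly
    by (intro Least_le exI[of _ m] exI[of _ Q] exI[of _ "\<lambda>e i. M e (h i)"] conjI refl)
  moreover have "{F. facet_in {..<m} F Q} \<subseteq>
      (\<lambda>j. {y\<in>Q. dotp {..<m} (A' j) y = b (l j)}) ` {..<card K}"
  proof
    fix F assume "F \<in> {F. facet_in {..<m} F Q}"
    then obtain j where "j < card K" "F = {y\<in>Q. dotp {..<m} (A' j) y = b (l j)}"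
      using facet_in_constraint[OF finite_lessThan Q_def, of F] by blast
    then show "F \<in> (\<lambda>j. {y\<in>Q. dotp {..<m} (A' j) y = b (l j)}) ` {..<card K}" by blast
  qed
  then have "card {F. facet_in {..<m} F Q} \<le> card K"
    using surj_card_le[OF finite_lessThan] by force
  ultimately show ?thesis by simp
qed

text \<open>Lets constraints be written as functions of the variables instead of coefficient
  vectors; the closure rules below supply the coefficients.\<close>

definition linear_in :: "'i set \<Rightarrow> (('i \<Rightarrow> real) \<Rightarrow> real) \<Rightarrow> bool" where
  "linear_in I L \<longleftrightarrow> (\<exists>a. \<forall>y. L y = (\<Sum>i\<in>I. a i * y i))"

lemma linear_in_zero: "linear_in I (\<lambda>y. 0)"
  unfolding linear_in_def by (intro exI[of _ "\<lambda>_. 0"]) simp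

lemma sum_unit_coeff:
  assumes "finite I" "i \<in> I"
  shows "(\<Sum>j\<in>I. (if j = i then 1 else 0) * y j) = (y i :: real)"
proof -
  have "(\<Sum>j\<in>I. (if j = i then 1 else 0) * y j) = (\<Sum>j\<in>I. if j = i then y j else 0)"
    by (intro sum.cong) auto
  then show ?thesis using assms by simp
qed

lemma linear_in_coord: "finite I \<Longrightarrow> i \<in> I \<Longrightarrow> linear_in I (\<lambda>y. y i)"
  unfolding linear_in_def using sum_unit_coeff by metis

lemma linear_in_add:
  assumes "linear_in I L" "linear_in I L'"
  shows "linear_in I (\<lambda>y. L y + L' y)"
proof -
  obtain a a' where "\<And>y. L y = (\<Sum>i\<in>I. a i * y i)" "\<And>y. L' y = (\<Sum>i\<in>I. a' i * y i)"
    using assms unfolding linear_in_def by blast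
  then show ?thesis unfolding linear_in_def
    by (intro exI[of _ "\<lambda>i. a i + a' i"]) (simp add: sum.distrib algebra_simps)
qed

lemma linear_in_minus:
  assumes "linear_in I L"
  shows "linear_in I (\<lambda>y. - L y)"
proof -
  obtain a where "\<And>y. L y = (\<Sum>i\<in>I. a i * y i)"
    using assms unfolding linear_in_def by blast
  then show ?thesis unfolding linear_in_def
    by (intro exI[of _ "\<lambda>i. - a i"]) (simp add: sum_negf)
qed

lemma linear_in_diff:
  "linear_in I L \<Longrightarrow> linear_in I L' \<Longrightarrow> linear_in I (\<lambda>y. L y - L' y)"
  using linear_in_add[OF _ linear_in_minus, of I L L'] by simp

lemma linear_in_sum:
  assumes "\<And>a. a \<in> B \<Longrightarrow> linear_in I (L a)"
  shows "linear_in I (\<lambda>y. \<Sum>a\<in>B. L a y)"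
  using assms
  by (induction B rule: infinite_finite_induct) (simp_all add: linear_in_zero linear_in_add)

lemma xc_le_linear:
  fixes L :: "'k \<Rightarrow> ('i \<Rightarrow> real) \<Rightarrow> real" and \<phi> :: "'d \<Rightarrow> 'i"
  assumes I: "finite I" and K: "finite K" and \<phi>: "\<And>e. e \<in> D \<Longrightarrow> \<phi> e \<in> I"
    and lin: "\<And>k. k \<in> K \<Longrightarrow> linear_in I (L k)"
    and P: "P = {\<lambda>e. if e \<in> D then y (\<phi> e) else 0 | y. \<forall>k\<in>K. L k y \<le> b k}"
  shows "xc D P \<le> card K"
proof -
  obtain A where A: "\<And>k y. k \<in> K \<Longrightarrow> L k y = (\<Sum>i\<in>I. A k i * y i)"
    using lin unfolding linear_in_def by metis
  have coord: "(\<Sum>i\<in>I. (if i = \<phi> e then 1 else 0) * y i) = y (\<phi> e)"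
    if "e \<in> D" for e and y :: "'i \<Rightarrow> real"
    by (rule sum_unit_coeff[OF I \<phi>[OF that]])
  show ?thesis
    by (rule xc_le[OF I K, where A = A and b = b and M = "\<lambda>e i. if i = \<phi> e then 1 else 0"])
      (simp add: P A coord cong: if_cong)
qed

section \<open>The radial cone\<close>

lemma finite_En [simp]: "finite (En n)"
  by (simp add: En_def Vn_def)

lemma card_En: "e \<in> En n \<Longrightarrow> card e = 2"
  by (simp add: En_def)

lemma is_Tjoin_iff:
  assumes "T \<subseteq> Vn n"
  shows "is_Tjoin n T J \<longleftrightarrow> J \<subseteq> En n \<and> odd_nodes J = T"
proof -
  have "v \<in> Vn n" if "J \<subseteq> En n" "v \<in> odd_nodes J" for v
    using that odd_nodes_subset[of J] unfolding En_def by blast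
  then show ?thesis using assms unfolding is_Tjoin_def by (auto simp: odd_nodes_def)
qed

lemma dotp_indicator:
  assumes "finite D" "J \<subseteq> D"
  shows "dotp D a (indicator J) = sum a J"
  unfolding sum_if_mem[OF assms] dotp_def by (intro sum.cong) (auto simp: indicator_def)

text \<open>A lower bound on joins passes to convex combinations, and nonnegative weights keep it
  when nonnegative vectors are added.\<close>

lemma dom_P_Tjoin_bound:
  assumes c0: "\<And>e. e \<in> En n \<Longrightarrow> 0 \<le> c e"
    and joins: "\<And>J. is_Tjoin n T J \<Longrightarrow> \<beta> \<le> sum c J" and y: "y \<in> dom_P_Tjoin n T"
  shows "\<beta> \<le> dotp (En n) c y"
proof -
  obtain p q where p: "p \<in> P_Tjoin n T" and q: "\<And>i. 0 \<le> q i" and ypq: "y = (\<lambda>i. p i + q i)"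
    using y unfolding dom_P_Tjoin_def dominant_def by blast
  obtain F u where F: "finite F" "F \<subseteq> {indicator J | J. is_Tjoin n T J}" "\<forall>z\<in>F. 0 \<le> u z"
    "sum u F = 1" "p = (\<lambda>i. \<Sum>z\<in>F. u z * z i)"
    using p unfolding P_Tjoin_def conv_hull_def by blast
  have "\<beta> \<le> dotp (En n) c z" if z: "z \<in> F" for z
  proof -
    obtain J where J: "is_Tjoin n T J" "z = indicator J" using F(2) z by blast
    then have "J \<subseteq> En n" by (simp add: is_Tjoin_def)
    then show ?thesis using joins[OF J(1)] J(2) by (simp add: dotp_indicator)
  qed
  then have "(\<Sum>z\<in>F. u z * \<beta>) \<le> (\<Sum>z\<in>F. u z * dotp (En n) c z)"
    using F(3) by (intro sum_mono mult_left_mono) auto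
  moreover have "(\<Sum>z\<in>F. u z * \<beta>) = \<beta>" using F(4) by (simp flip: sum_distrib_right)
  moreover have "(\<Sum>z\<in>F. u z * dotp (En n) c z) = dotp (En n) c p"
    unfolding dotp_def F(5) sum_distrib_left
    by (subst sum.swap) (simp add: mult.left_commute)
  moreover have "dotp (En n) c y = dotp (En n) c p + dotp (En n) c q"
    unfolding dotp_def ypq by (simp add: sum.distrib algebra_simps)
  moreover have "0 \<le> dotp (En n) c q"
    unfolding dotp_def using c0 q by (intro sum_nonneg mult_nonneg_nonneg) auto
  ultimately show ?thesis by simp
qed

lemma indicator_plus_in_dom:
  assumes "is_Tjoin n T J" "r \<in> fspace (En n)" "\<And>i. 0 \<le> r i"
  shows "(\<lambda>i. indicator J i + r i) \<in> dom_P_Tjoin n T"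
proof -
  have "indicator J \<in> P_Tjoin n T"
    unfolding P_Tjoin_def conv_hull_def mem_Collect_eq using assms(1)
    by (intro exI[of _ "{indicator J}"] exI[of _ "\<lambda>_. 1"]) auto
  then show ?thesis using assms(2,3) unfolding dom_P_Tjoin_def dominant_def by blast
qed

text \<open>An explicit inequality system for the radial cone at a \<open>T\<close>-join, shown to
  be correct by the next two lemmas. \<open>S\<close> need not lie in \<open>Vn n\<close>, as only
  its trace there decides which edges of \<open>En n\<close> cross.\<close>

definition join_cone :: "nat \<Rightarrow> nat set set \<Rightarrow> (nat set \<Rightarrow> real) set" where
  "join_cone n J = {x \<in> fspace (En n). (\<forall>e\<in>En n - J. 0 \<le> x e) \<and>
     (\<forall>S. card (J \<inter> cut S) = 1 \<longrightarrow> 1 \<le> sum x (En n \<inter> cut S))}"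

text \<open>All these inequalities have the form \<open>|J \<inter> A| \<le> x(A)\<close>, with
  \<open>A\<close> an edge off \<open>J\<close> or a cut. Every \<open>T\<close>-join meets a cut as
  often as \<open>J\<close> does modulo 2, hence at least once if \<open>J\<close> crosses
  once.\<close>

lemma radial_cone_subset_join_cone:
  assumes T: "T \<subseteq> Vn n" and J: "is_Tjoin n T J"
  shows "radial_cone (En n) (dom_P_Tjoin n T) (indicator J) \<subseteq> join_cone n J"
proof
  fix x assume x: "x \<in> radial_cone (En n) (dom_P_Tjoin n T) (indicator J)"
  have JE: "J \<subseteq> En n" and Jon: "odd_nodes J = T" using J is_Tjoin_iff[OF T] by auto
  have bound: "\<beta> \<le> sum x A" if A: "A \<subseteq> En n" "real (card (J \<inter> A)) = \<beta>"
    and joins: "\<And>J'. is_Tjoin n T J' \<Longrightarrow> \<beta> \<le> real (card (J' \<inter> A))" for A \<beta>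
  proof -
    define c :: "nat set \<Rightarrow> real" where "c e = (if e \<in> A then 1 else 0)" for e
    have card: "sum c J' = real (card (J' \<inter> A))" if "J' \<subseteq> En n" for J'
      using finite_subset[OF that finite_En] by (simp add: c_def sum.If_cases)
    have neg: "dotp (En n) (\<lambda>e. - c e) y = - dotp (En n) c y" for y
      by (simp add: dotp_def sum_negf)
    have "\<forall>y\<in>dom_P_Tjoin n T. dotp (En n) (\<lambda>e. - c e) y \<le> - \<beta>"
    proof
      fix y assume "y \<in> dom_P_Tjoin n T"
      then have "\<beta> \<le> dotp (En n) c y"
        using joins card by (intro dom_P_Tjoin_bound) (auto simp: c_def is_Tjoin_def)
      then show "dotp (En n) (\<lambda>e. - c e) y \<le> - \<beta>" by (simp add: neg)
    qed
    moreover have "dotp (En n) (\<lambda>e. - c e) (indicator J) = - \<beta>"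
      using dotp_indicator[OF finite_En JE, of c] card[OF JE] A(2) by (simp add: neg)
    ultimately have "dotp (En n) (\<lambda>e. - c e) x \<le> - \<beta>"
      using x unfolding radial_cone_def by blast
    moreover have "dotp (En n) c x = sum x A"
      unfolding sum_if_mem[OF finite_En A(1)] dotp_def c_def by (intro sum.cong) auto
    ultimately show ?thesis by (simp add: neg)
  qed
  have "0 \<le> x e" if "e \<in> En n - J" for e
    using bound[of "{e}" 0] that by auto
  moreover have "1 \<le> sum x (En n \<inter> cut S)" if S: "card (J \<inter> cut S) = 1" for S
  proof (rule bound)
    show "real (card (J \<inter> (En n \<inter> cut S))) = 1"
      using S JE by (metis Int_assoc inf.absorb1 of_nat_1)
    fix J' assume "is_Tjoin n T J'"
    then have J': "J' \<subseteq> En n" "odd_nodes J' = T" using is_Tjoin_iff[OF T] by auto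
    have par: "odd (card (K \<inter> cut S)) \<longleftrightarrow> odd (card (odd_nodes K \<inter> S))" if "K \<subseteq> En n" for K
      using that finite_subset[OF that finite_En] card_En by (intro odd_card_cut) auto
    have "odd (card (J' \<inter> cut S))" using par[OF J'(1)] par[OF JE] J'(2) Jon S by simp
    moreover have "J' \<inter> (En n \<inter> cut S) = J' \<inter> cut S" using J'(1) by blast
    ultimately show "1 \<le> real (card (J' \<inter> (En n \<inter> cut S)))"
      by (cases "card (J' \<inter> cut S)") auto
  qed auto
  ultimately show "x \<in> join_cone n J"
    using x by (simp add: join_cone_def radial_cone_def)
qed

text \<open>A valid inequality has nonpositive coefficients, because the dominant contains
  \<open>indicator J\<close> plus the unit vector of any edge. Negated, they are weights for which
  tightness makes \<open>J\<close> a minimum join.\<close>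

lemma join_cone_subset_radial_cone:
  assumes T: "T \<subseteq> Vn n" and J: "is_Tjoin n T J"
  shows "join_cone n J \<subseteq> radial_cone (En n) (dom_P_Tjoin n T) (indicator J)"
proof
  fix x assume x: "x \<in> join_cone n J"
  have JE: "J \<subseteq> En n" and Jon: "odd_nodes J = T" using J is_Tjoin_iff[OF T] by auto
  have "dotp (En n) a x \<le> b" if valid: "\<forall>y\<in>dom_P_Tjoin n T. dotp (En n) a y \<le> b"
    and tight: "dotp (En n) a (indicator J) = b" for a b
  proof -
    have aJ: "sum a J = b" using tight dotp_indicator[OF finite_En JE] by simp
    have a0: "a e \<le> 0" if e: "e \<in> En n" for e
    proof -
      have "(\<lambda>i. indicator J i + indicator {e} i) \<in> dom_P_Tjoin n T"
        using e by (intro indicator_plus_in_dom[OF J]) (auto simp: fspace_def indicator_def)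
      then have "dotp (En n) a (\<lambda>i. indicator J i + indicator {e} i) \<le> b" using valid by blast
      moreover have "dotp (En n) a (\<lambda>i. indicator J i + indicator {e} i) =
          dotp (En n) a (indicator J) + dotp (En n) a (indicator {e})"
        by (simp add: dotp_def sum.distrib algebra_simps)
      ultimately show ?thesis using tight dotp_indicator[of "En n" "{e}" a] e by simp
    qed
    have "sum (\<lambda>e. - a e) J \<le> (\<Sum>e\<in>En n. - a e * x e)"
    proof (rule optimal_join_weight_le[OF finite_En card_En JE])
      show "sum (\<lambda>e. - a e) J \<le> sum (\<lambda>e. - a e) J'"
        if J': "J' \<subseteq> En n" "odd_nodes J' = odd_nodes J" for J'
      proof -
        have "is_Tjoin n T J'" using J' Jon is_Tjoin_iff[OF T] by simp
        then have "(\<lambda>i. indicator J' i + 0) \<in> dom_P_Tjoin n T"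
          by (rule indicator_plus_in_dom) (auto simp: fspace_def)
        then have "dotp (En n) a (indicator J') \<le> b" using valid by auto
        then show ?thesis using dotp_indicator[OF finite_En J'(1)] aJ by (simp add: sum_negf)
      qed
    qed (use a0 x in \<open>auto simp: join_cone_def\<close>)
    then show ?thesis using aJ by (simp add: dotp_def sum_negf)
  qed
  then show "x \<in> radial_cone (En n) (dom_P_Tjoin n T) (indicator J)"
    using x by (auto simp: join_cone_def radial_cone_def)
qed

section \<open>Cut inequalities as flow conditions\<close>

lemma sum_cut_arcs:
  fixes h :: "nat set \<Rightarrow> real"
  assumes "S \<subseteq> Vn n"
  shows "sum h (En n \<inter> cut S) = (\<Sum>(w, u)\<in>(Vn n - S) \<times> S. h {w, u})"
proof -
  have inj: "inj_on (\<lambda>(w, u). {w, u}) ((Vn n - S) \<times> S)"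
    by (auto simp: inj_on_def doubleton_eq_iff)
  have "(\<lambda>(w, u). {w, u}) ` ((Vn n - S) \<times> S) = En n \<inter> cut S"
  proof (intro equalityI subsetI)
    fix e assume "e \<in> (\<lambda>(w, u). {w, u}) ` ((Vn n - S) \<times> S)"
    then obtain w u where "e = {w, u}" "w \<in> Vn n" "w \<notin> S" "u \<in> S" by auto
    then show "e \<in> En n \<inter> cut S" using assms by (auto simp: En_def cut_def card_2_iff)
  next
    fix e assume e: "e \<in> En n \<inter> cut S"
    then have "e \<subseteq> Vn n" "card e = 2" by (auto simp: En_def)
    then obtain a b where ab: "e = {a, b}" "a \<in> Vn n" "b \<in> Vn n" by (auto simp: card_2_iff)
    show "e \<in> (\<lambda>(w, u). {w, u}) ` ((Vn n - S) \<times> S)"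
    proof (cases "a \<in> S")
      case True
      then have "b \<notin> S" using e ab by (auto simp: cut_def)
      then show ?thesis using True ab by (intro image_eqI[of _ _ "(b, a)"]) auto
    next
      case False
      then have "b \<in> S" using e ab by (auto simp: cut_def)
      then show ?thesis using False ab by (intro image_eqI[of _ _ "(a, b)"]) auto
    qed
  qed
  then have "sum h (En n \<inter> cut S) = sum h ((\<lambda>(w, u). {w, u}) ` ((Vn n - S) \<times> S))" by simp
  also have "\<dots> = (\<Sum>(w, u)\<in>(Vn n - S) \<times> S. h {w, u})"
    using sum.reindex[OF inj, of h] by (simp add: case_prod_unfold comp_def)
  finally show ?thesis .
qed

lemma sum_times_columns:
  assumes "finite A" "finite B"
  shows "sum g (A \<times> B) = (\<Sum>u\<in>B. sum g (A \<times> {u}))"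
proof -
  have "A \<times> B = (\<Union>u\<in>B. A \<times> {u})" by auto
  then show ?thesis using assms by (simp only:) (intro sum.UNION_disjoint, auto)
qed

lemma sum_times_rows:
  assumes "finite A" "finite B"
  shows "sum g (A \<times> B) = (\<Sum>u\<in>A. sum g ({u} \<times> B))"
proof -
  have "A \<times> B = (\<Union>u\<in>A. {u} \<times> B)" by auto
  then show ?thesis using assms by (simp only:) (intro sum.UNION_disjoint, auto)
qed

lemma edge_ends:
  assumes "f \<in> En n"
  shows "f = {Min f, Max f}" "Min f \<in> Vn n" "Max f \<in> Vn n" "Min f \<noteq> Max f"
proof -
  obtain a b where ab: "f = {a, b}" "a \<noteq> b" using assms by (auto simp: En_def card_2_iff)
  have "finite f" "f \<noteq> {}" using ab by auto
  then have mem: "Min f \<in> f" "Max f \<in> f" using Min_in Max_in by auto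
  show ne: "Min f \<noteq> Max f" using ab by (auto simp: min_def max_def split: if_splits)
  show "f = {Min f, Max f}" using mem ne ab by auto
  show "Min f \<in> Vn n" "Max f \<in> Vn n" using mem assms by (auto simp: En_def)
qed

text \<open>For an edge \<open>f = {s, t}\<close> of \<open>J\<close>, the inequalities of \<open>join_cone\<close> at cuts meeting \<open>J\<close> only in
  \<open>f\<close> say that \<open>1 - x f\<close> units can be sent from \<open>s = Min f\<close> to \<open>t = Max f\<close> without using \<open>f\<close>, where
  the other edges of \<open>J\<close> are uncapacitated.\<close>

definition join_flow ::
    "nat \<Rightarrow> nat set set \<Rightarrow> (nat set \<Rightarrow> real) \<Rightarrow> nat set \<Rightarrow> (nat \<times> nat \<Rightarrow> real) \<Rightarrow> bool" where
  "join_flow n J x f g \<longleftrightarrow>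
     (\<forall>a\<in>Vn n \<times> Vn n. 0 \<le> g a) \<and>
     (\<forall>u\<in>Vn n. \<forall>w\<in>Vn n. {u, w} \<notin> J - {f} \<longrightarrow>
        g (u, w) \<le> (if {u, w} \<in> En n - J then x {u, w} else 0)) \<and>
     (\<forall>u\<in>Vn n - {Min f}. (if u = Max f then 1 - x f else 0) \<le>
        sum g (Vn n \<times> {u}) - sum g ({u} \<times> Vn n))"

lemma exists_join_flow:
  assumes x: "x \<in> join_cone n J" and JE: "J \<subseteq> En n" and f: "f \<in> J"
  shows "\<exists>g. join_flow n J x f g"
proof -
  have fE: "f \<in> En n" using f JE by blast
  note fe = edge_ends[OF fE]
  have finV: "finite (Vn n)" by (simp add: Vn_def)
  \<comment> \<open>The value is cut off at 0, since \<open>x f\<close> may exceed 1. Capacity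
    \<open>val\<close> on the other edges of \<open>J\<close> is as good as unbounded, and
    \<open>f\<close> itself gets capacity 0.\<close>
  define val where "val = max 0 (1 - x f)"
  define h where "h e = (if e \<in> J - {f} then val else if e \<in> En n - J then x e else 0)" for e
  have h0: "0 \<le> h e" for e using x by (auto simp: h_def val_def join_cone_def)
  have cuts: "val \<le> (\<Sum>a\<in>(Vn n - S) \<times> S. h {fst a, snd a})"
    if S: "S \<subseteq> Vn n" "Max f \<in> S" "Min f \<notin> S" for S
  proof -
    have eq: "(\<Sum>a\<in>(Vn n - S) \<times> S. h {fst a, snd a}) = sum h (En n \<inter> cut S)"
      unfolding sum_cut_arcs[OF S(1)] by (simp add: case_prod_unfold)
    have fcut: "f \<in> cut S" using fe(1) S unfolding cut_def by blast
    show ?thesis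
    \<comment> \<open>If \<open>J\<close> crosses only in \<open>f\<close>, the cone inequality
      without its term at \<open>f\<close> suffices; otherwise another edge of \<open>J\<close>
      alone provides \<open>val\<close>.\<close>
    proof (cases "J \<inter> cut S = {f}")
      case True
      then have "card (J \<inter> cut S) = 1" by simp
      then have "1 \<le> sum x (En n \<inter> cut S)" using x unfolding join_cone_def by blast
      also have "\<dots> = x f + sum x (En n \<inter> cut S - {f})"
        using fcut fE by (intro sum.remove) auto
      also have "sum x (En n \<inter> cut S - {f}) = sum h (En n \<inter> cut S - {f})"
        using True by (intro sum.cong) (auto simp: h_def)
      also have "\<dots> \<le> sum h (En n \<inter> cut S)" using h0 by (intro sum_mono2) auto
      finally show ?thesis using h0 unfolding eq val_def by (simp add: sum_nonneg)
    next
      case False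
      then obtain e where e: "e \<in> J" "e \<in> cut S" "e \<noteq> f" using f fcut by blast
      then have "h e = val" by (simp add: h_def)
      moreover have "h e \<le> sum h (En n \<inter> cut S)"
        using e JE h0 by (intro member_le_sum) auto
      ultimately show ?thesis unfolding eq by simp
    qed
  qed
  obtain g :: "nat \<times> nat \<Rightarrow> real" where g: "\<And>a. 0 \<le> g a" "\<And>a. g a \<le> h {fst a, snd a}"
    "\<And>u. u \<in> Vn n - {Min f} \<Longrightarrow>
      (if u = Max f then val else 0) \<le> sum g (Vn n \<times> {u}) - sum g ({u} \<times> Vn n)"
  proof (rule exists_flow_of_cuts[where k = "\<lambda>a. h {fst a, snd a}" and s = "Min f" and val = val,
      OF finV fe(3) h0 cuts])
    fix g :: "nat \<times> nat \<Rightarrow> real"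
    assume "\<And>a. 0 \<le> g a" "\<And>a. g a \<le> h {fst a, snd a}"
      "\<And>u. u \<in> Vn n - {Min f} \<Longrightarrow>
        (if u = Max f then val else 0) \<le> sum g (Vn n \<times> {u}) - sum g ({u} \<times> Vn n)"
    then show thesis by (rule that)
  qed
  have "join_flow n J x f g"
    unfolding join_flow_def
  proof (intro conjI ballI impI)
    show "0 \<le> g a" for a by (rule g(1))
    show "g (u, w) \<le> (if {u, w} \<in> En n - J then x {u, w} else 0)" if "{u, w} \<notin> J - {f}" for u w
      using g(2)[of "(u, w)"] unfolding h_def fst_conv snd_conv if_not_P[OF that] .
    show "(if u = Max f then 1 - x f else 0) \<le> sum g (Vn n \<times> {u}) - sum g ({u} \<times> Vn n)"
      if "u \<in> Vn n - {Min f}" for u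
      using g(3)[OF that] by (cases "u = Max f") (simp_all add: val_def)
  qed
  then show ?thesis by blast
qed

text \<open>Summing the conservation inequalities over the side of the cut that contains
  \<open>Max f\<close> bounds \<open>1 - x f\<close> by the capacity entering it. Nonnegativity of
  \<open>x\<close> off \<open>J\<close> is read off the capacity bounds, which takes some
  \<open>f\<close> in \<open>J\<close>.\<close>

lemma join_flows_imp_join_cone:
  assumes J: "J \<subseteq> En n" "J \<noteq> {}" and xE: "x \<in> fspace (En n)"
    and flows: "\<And>f. f \<in> J \<Longrightarrow> \<exists>g. join_flow n J x f g"
  shows "x \<in> join_cone n J"
proof -
  have finV: "finite (Vn n)" by (simp add: Vn_def)
  have "0 \<le> x e" if e: "e \<in> En n - J" for e
  proof -
    obtain f where f: "f \<in> J" using J(2) by blast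
    obtain g where g: "join_flow n J x f g" using flows[OF f] by blast
    have eE: "e \<in> En n" using e by blast
    note ee = edge_ends[OF eE]
    have "0 \<le> g (Min e, Max e)" using g ee unfolding join_flow_def by blast
    also have "\<dots> \<le> (if {Min e, Max e} \<in> En n - J then x {Min e, Max e} else 0)"
    proof -
      have "{Min e, Max e} \<notin> J - {f}" using e ee(1) by simp
      then show ?thesis using g ee(2,3) unfolding join_flow_def by blast
    qed
    finally show ?thesis using e ee(1) by simp
  qed
  moreover have "1 \<le> sum x (En n \<inter> cut S)" if S: "card (J \<inter> cut S) = 1" for S
  proof -
    obtain f where f: "J \<inter> cut S = {f}" using S by (auto simp: card_1_singleton_iff)
    then have fJ: "f \<in> J" "f \<in> cut S" by blast+
    then have fE: "f \<in> En n" using J by blast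
    note fe = edge_ends[OF fE]
    obtain g where g: "join_flow n J x f g" using flows[OF fJ(1)] by blast
    \<comment> \<open>The same cut, with its side chosen to contain the sink and restricted to
      \<open>Vn n\<close>.\<close>
    define R where "R = (if Max f \<in> S then Vn n \<inter> S else Vn n - S)"
    have RV: "R \<subseteq> Vn n" by (auto simp: R_def)
    have cutR: "En n \<inter> cut R = En n \<inter> cut S"
    proof -
      have "e \<in> cut R \<longleftrightarrow> e \<in> cut S" if "e \<in> En n" for e
      proof -
        have "e \<subseteq> Vn n" using that by (simp add: En_def)
        then show ?thesis unfolding cut_def R_def by auto
      qed
      then show ?thesis by blast
    qed
    have MaxR: "Max f \<in> R" using fe(3) by (simp add: R_def)
    moreover have "Min f \<notin> R"
    proof
      assume "Min f \<in> R"
      then have "{Min f, Max f} \<subseteq> R" using MaxR by blast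
      then have "f \<notin> cut R" unfolding cut_def fe(1)[symmetric] by blast
      then show False using cutR fJ fE by blast
    qed
    ultimately have mem: "Max f \<in> R" "Min f \<notin> R" .
    have finR: "finite R" using RV finV finite_subset by blast
    have g0: "0 \<le> g a" if "a \<in> Vn n \<times> Vn n" for a using g that unfolding join_flow_def by blast
    have gcap: "\<forall>u\<in>Vn n. \<forall>w\<in>Vn n. {u, w} \<notin> J - {f} \<longrightarrow>
        g (u, w) \<le> (if {u, w} \<in> En n - J then x {u, w} else 0)"
      using g unfolding join_flow_def by (elim conjE)
    have "1 - x f = (\<Sum>u\<in>R. if u = Max f then 1 - x f else 0)" using mem finR by simp
    also have "\<dots> \<le> (\<Sum>u\<in>R. sum g (Vn n \<times> {u}) - sum g ({u} \<times> Vn n))"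
      using g RV mem unfolding join_flow_def by (intro sum_mono) blast
    also have "\<dots> = sum g (Vn n \<times> R) - sum g (R \<times> Vn n)"
      by (simp add: sum_subtractf sum_times_columns[OF finV finR] sum_times_rows[OF finR finV])
    also have "sum g (Vn n \<times> R) = sum g ((Vn n - R) \<times> R) + sum g (R \<times> R)"
      using finV finR RV by (subst sum.union_disjoint[symmetric]) (auto intro: sum.cong)
    also have "sum g ((Vn n - R) \<times> R) + sum g (R \<times> R) - sum g (R \<times> Vn n)
        \<le> sum g ((Vn n - R) \<times> R)"
    proof -
      have "sum g (R \<times> R) \<le> sum g (R \<times> Vn n)"
        using finV finR RV g0 by (intro sum_mono2) auto
      then show ?thesis by simp
    qed
    \<comment> \<open>\<open>f\<close> is the only edge of \<open>J\<close> in the cut, so every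
      crossing arc is capacitated, and an arc along \<open>f\<close> carries nothing.\<close>
    also have "\<dots> \<le> (\<Sum>(w, u)\<in>(Vn n - R) \<times> R. (\<lambda>e. if e = f then 0 else x e) {w, u})"
    proof (rule sum_mono)
      fix a assume "a \<in> (Vn n - R) \<times> R"
      then obtain w u where a: "a = (w, u)" "w \<in> Vn n" "w \<notin> R" "u \<in> R" by auto
      have "{w, u} \<in> En n" using a RV by (auto simp: En_def card_2_iff)
      moreover have "{w, u} \<in> cut R" using a by (auto simp: cut_def)
      ultimately have wu: "{w, u} \<in> En n" "{w, u} \<in> cut S" using cutR by blast+
      have "e \<in> J \<longleftrightarrow> e = f" if "e \<in> cut S" for e using f that by blast
      from this[OF wu(2)] have nJ: "{w, u} \<in> J \<longleftrightarrow> {w, u} = f" .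
      have uV: "u \<in> Vn n" using a(4) RV by (rule subsetD[rotated])
      have "{w, u} \<notin> J - {f}" using nJ by simp
      from gcap[rule_format, OF a(2) uV this]
      have "g (w, u) \<le> (if {w, u} \<in> En n - J then x {w, u} else 0)" .
      then show "g a \<le> (case a of (w, u) \<Rightarrow> (\<lambda>e. if e = f then 0 else x e) {w, u})"
        using wu nJ a(1) by (cases "{w, u} = f") simp_all
    qed
    also have "\<dots> = (\<Sum>e\<in>En n \<inter> cut S. if e = f then 0 else x e)"
      using sum_cut_arcs[OF RV, of "\<lambda>e. if e = f then 0 else x e"] cutR by simp
    also have "\<dots> = sum x (En n \<inter> cut S) - x f"
    proof -
      have fmem: "f \<in> En n \<inter> cut S" using fE fJ by blast
      have "(\<Sum>e\<in>En n \<inter> cut S - {f}. if e = f then 0 else x e) = sum x (En n \<inter> cut S - {f})"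
        by (intro sum.cong) auto
      then show ?thesis
        using sum.remove[OF _ fmem, of "\<lambda>e. if e = f then 0 else x e"] sum.remove[OF _ fmem, of x]
        by simp
    qed
    finally show ?thesis by simp
  qed
  ultimately show ?thesis using xE by (simp add: join_cone_def)
qed

lemma xc_join_cone_le:
  assumes J: "J \<subseteq> En n" "J \<noteq> {}"
  shows "xc (En n) (join_cone n J) \<le> card J * (n * n + (n * n + n))"
proof -
  let ?V = "Vn n" and ?E = "En n"
  define I where "I = ?E <+> (J \<times> (?V \<times> ?V))"
  \<comment> \<open>For each \<open>f\<close>: nonnegativity and capacity of every arc, and
    conservation at every node.\<close>
  define K where "K = J \<times> ((?V \<times> ?V) <+> ((?V \<times> ?V) <+> ?V))"
  \<comment> \<open>To keep the index set a full product, places without a condition (arcs along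
    other edges of \<open>J\<close>, the node \<open>Min f\<close>) get the trivial inequality
    \<open>0 \<le> 0\<close>.\<close>
  define L :: "nat set \<times> (nat \<times> nat + (nat \<times> nat + nat)) \<Rightarrow>
      (nat set + (nat set \<times> (nat \<times> nat)) \<Rightarrow> real) \<Rightarrow> real"
    where "L k y = (case k of
      (f, Inl a) \<Rightarrow> - y (Inr (f, a))
    | (f, Inr (Inl (u, w))) \<Rightarrow>
        if {u, w} \<in> J - {f} then 0
        else if {u, w} \<in> ?E - J then y (Inr (f, (u, w))) - y (Inl {u, w}) else y (Inr (f, (u, w)))
    | (f, Inr (Inr u)) \<Rightarrow>
        if u = Min f then 0
        else (\<Sum>a\<in>{u} \<times> ?V. y (Inr (f, a))) - (\<Sum>a\<in>?V \<times> {u}. y (Inr (f, a)))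
          - (if u = Max f then y (Inl f) else 0))" for k y
  \<comment> \<open>The only nonzero constant is the 1 of \<open>1 - x f\<close>, which changes sign
    because all variables are moved to the left side.\<close>
  define b :: "nat set \<times> (nat \<times> nat + (nat \<times> nat + nat)) \<Rightarrow> real"
    where "b k = (case k of (f, Inl a) \<Rightarrow> 0 | (f, Inr (Inl a)) \<Rightarrow> 0
      | (f, Inr (Inr u)) \<Rightarrow> if u \<noteq> Min f \<and> u = Max f then - 1 else 0)" for k
  have finJ: "finite J" using J finite_subset[OF _ finite_En] by blast
  have finV: "finite ?V" by (simp add: Vn_def)
  have finI: "finite I" using finJ finV by (simp add: I_def)
  have finK: "finite K" using finJ finV by (simp add: K_def)
  have lin: "linear_in I (L k)" if k: "k \<in> K" for k
  proof -
    obtain f c where kc: "k = (f, c)" "f \<in> J" "c \<in> (?V \<times> ?V) <+> ((?V \<times> ?V) <+> ?V)"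
      using k by (auto simp: K_def)
    have fE: "f \<in> ?E" using kc J by blast
    have arc: "linear_in I (\<lambda>y. y (Inr (f, a)))" if "a \<in> ?V \<times> ?V" for a
      using that kc finI by (intro linear_in_coord) (auto simp: I_def)
    have edge: "linear_in I (\<lambda>y. y (Inl e))" if "e \<in> ?E" for e
      using that finI by (intro linear_in_coord) (auto simp: I_def)
    consider a where "c = Inl a" "a \<in> ?V \<times> ?V" | u w where "c = Inr (Inl (u, w))" "u \<in> ?V" "w \<in> ?V"
      | u where "c = Inr (Inr u)" "u \<in> ?V"
      using kc(3) by auto
    then show ?thesis
    proof cases
      case (1 a)
      then have "L k = (\<lambda>y. - y (Inr (f, a)))" by (simp add: L_def kc fun_eq_iff)
      then show ?thesis using arc[OF 1(2)] by (simp add: linear_in_minus)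
    next
      case (2 u w)
      then have L: "L k = (\<lambda>y. if {u, w} \<in> J - {f} then 0
        else if {u, w} \<in> ?E - J then y (Inr (f, (u, w))) - y (Inl {u, w}) else y (Inr (f, (u, w))))"
        by (simp add: L_def kc fun_eq_iff)
      have a: "(u, w) \<in> ?V \<times> ?V" using 2 by simp
      consider "{u, w} \<in> J - {f}" | "{u, w} \<notin> J - {f}" "{u, w} \<in> ?E - J"
        | "{u, w} \<notin> J - {f}" "{u, w} \<notin> ?E - J" by blast
      then show ?thesis
      proof cases
        case 1
        then have "L k = (\<lambda>y. 0)" unfolding L by (simp only: if_True)
        then show ?thesis by (simp add: linear_in_zero)
      next
        case 2
        then have "L k = (\<lambda>y. y (Inr (f, (u, w))) - y (Inl {u, w}))"
          unfolding L by (simp only: if_True if_False)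
        then show ?thesis using arc[OF a] edge[of "{u, w}"] 2 by (simp add: linear_in_diff)
      next
        case 3
        then have "L k = (\<lambda>y. y (Inr (f, (u, w))))" unfolding L by (simp only: if_False)
        then show ?thesis using arc[OF a] by simp
      qed
    next
      case (3 u)
      then have L: "L k = (\<lambda>y. if u = Min f then 0
        else (\<Sum>a\<in>{u} \<times> ?V. y (Inr (f, a))) - (\<Sum>a\<in>?V \<times> {u}. y (Inr (f, a)))
          - (if u = Max f then y (Inl f) else 0))"
        by (simp add: L_def kc fun_eq_iff)
      have out: "linear_in I (\<lambda>y. \<Sum>a\<in>{u} \<times> ?V. y (Inr (f, a)))"
        using 3 by (intro linear_in_sum arc) auto
      have inn: "linear_in I (\<lambda>y. \<Sum>a\<in>?V \<times> {u}. y (Inr (f, a)))"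
        using 3 by (intro linear_in_sum arc) auto
      have "linear_in I (\<lambda>y. if u = Max f then y (Inl f) else 0)"
        using edge[OF fE] linear_in_zero by (cases "u = Max f") simp_all
      then show ?thesis unfolding L using out inn linear_in_zero
        by (cases "u = Min f") (simp_all add: linear_in_diff)
    qed
  qed
  have iff: "(\<forall>k\<in>K. L k y \<le> b k) \<longleftrightarrow>
      (\<forall>f\<in>J. join_flow n J (\<lambda>e. if e \<in> ?E then y (Inl e) else 0) f (\<lambda>a. y (Inr (f, a))))" for y
  proof -
    have "(\<forall>k\<in>K. L k y \<le> b k) \<longleftrightarrow> (\<forall>f\<in>J. (\<forall>a\<in>?V \<times> ?V. L (f, Inl a) y \<le> b (f, Inl a)) \<and>
        (\<forall>u\<in>?V. \<forall>w\<in>?V. L (f, Inr (Inl (u, w))) y \<le> b (f, Inr (Inl (u, w)))) \<and>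
        (\<forall>u\<in>?V. L (f, Inr (Inr u)) y \<le> b (f, Inr (Inr u))))"
      unfolding K_def by (auto simp: Plus_def)
    also have "\<dots> \<longleftrightarrow>
      (\<forall>f\<in>J. join_flow n J (\<lambda>e. if e \<in> ?E then y (Inl e) else 0) f (\<lambda>a. y (Inr (f, a))))"
    proof (intro ball_cong refl)
      fix f assume "f \<in> J"
      then have fE: "f \<in> ?E" using J by blast
      have 1: "L (f, Inl a) y \<le> b (f, Inl a) \<longleftrightarrow> 0 \<le> y (Inr (f, a))" for a
        by (simp add: L_def b_def)
      have 2: "L (f, Inr (Inl (u, w))) y \<le> b (f, Inr (Inl (u, w))) \<longleftrightarrow>
        ({u, w} \<notin> J - {f} \<longrightarrow> y (Inr (f, (u, w))) \<le>
          (if {u, w} \<in> ?E - J then if {u, w} \<in> ?E then y (Inl {u, w}) else 0 else 0))" for u w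
        by (simp add: L_def b_def)
      have 3: "L (f, Inr (Inr u)) y \<le> b (f, Inr (Inr u)) \<longleftrightarrow> (u \<noteq> Min f \<longrightarrow>
        (if u = Max f then 1 - (if f \<in> ?E then y (Inl f) else 0) else 0) \<le>
          (\<Sum>a\<in>?V \<times> {u}. y (Inr (f, a))) - (\<Sum>a\<in>{u} \<times> ?V. y (Inr (f, a))))" for u
        using fE by (auto simp: L_def b_def)
      show "((\<forall>a\<in>?V \<times> ?V. L (f, Inl a) y \<le> b (f, Inl a)) \<and>
        (\<forall>u\<in>?V. \<forall>w\<in>?V. L (f, Inr (Inl (u, w))) y \<le> b (f, Inr (Inl (u, w)))) \<and>
        (\<forall>u\<in>?V. L (f, Inr (Inr u)) y \<le> b (f, Inr (Inr u)))) =
        join_flow n J (\<lambda>e. if e \<in> ?E then y (Inl e) else 0) f (\<lambda>a. y (Inr (f, a)))"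
        unfolding 1 2 3 join_flow_def by blast
    qed
    finally show ?thesis .
  qed
  have cone: "join_cone n J =
      {\<lambda>e. if e \<in> ?E then y (Inl e) else 0 | y. \<forall>k\<in>K. L k y \<le> b k}" (is "_ = ?R")
  proof (intro equalityI subsetI)
    fix x assume x: "x \<in> join_cone n J"
    have "\<forall>f\<in>J. \<exists>g. join_flow n J x f g" using exists_join_flow[OF x J(1)] by blast
    then obtain g where g: "\<forall>f\<in>J. join_flow n J x f (g f)" by metis
    define y where "y i = (case i of Inl e \<Rightarrow> x e | Inr (f, a) \<Rightarrow> g f a)" for i
    have xy: "x = (\<lambda>e. if e \<in> ?E then y (Inl e) else 0)"
      using x by (auto simp: y_def join_cone_def fspace_def)
    have "(\<lambda>a. y (Inr (f, a))) = g f" for f by (simp add: y_def)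
    then have "\<forall>k\<in>K. L k y \<le> b k" unfolding iff xy[symmetric] using g by simp
    then show "x \<in> ?R" using xy by blast
  next
    fix x assume "x \<in> ?R"
    then obtain y where y: "x = (\<lambda>e. if e \<in> ?E then y (Inl e) else 0)" "\<forall>k\<in>K. L k y \<le> b k"
      by blast
    have "\<forall>f\<in>J. join_flow n J x f (\<lambda>a. y (Inr (f, a)))" using y(2) unfolding iff y(1) .
    moreover have "x \<in> fspace ?E" by (simp add: y(1) fspace_def)
    ultimately show "x \<in> join_cone n J" by (intro join_flows_imp_join_cone[OF J]) blast+
  qed
  have "xc ?E (join_cone n J) \<le> card K"
    by (rule xc_le_linear[OF finI finK _ lin cone]) (auto simp: I_def)
  also have "card K = card J * (n * n + (n * n + n))"
    using finV by (simp add: K_def card_cartesian_product card_Plus Vn_def)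
  finally show ?thesis .
qed

theorem theorem3:
  shows "\<exists>C::real. C > 0 \<and>
    (\<forall>n T J. T \<subseteq> Vn n \<longrightarrow> even (card T) \<longrightarrow> is_Tjoin n T J \<longrightarrow> J \<noteq> {} \<longrightarrow>
       is_vertex (indicator J) (dom_P_Tjoin n T) \<longrightarrow>
       real (xc (En n) (radial_cone (En n) (dom_P_Tjoin n T) (indicator J)))
         \<le> C * real (card J) * real n ^ 2)"
proof (intro exI[of _ 3] conjI allI impI)
  fix n T J
  assume T: "T \<subseteq> Vn n" and J: "is_Tjoin n T J" "J \<noteq> {}"
  have JE: "J \<subseteq> En n" using J by (simp add: is_Tjoin_def)
  have "radial_cone (En n) (dom_P_Tjoin n T) (indicator J) = join_cone n J"
    using radial_cone_subset_join_cone[OF T J(1)] join_cone_subset_radial_cone[OF T J(1)] by blast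
  then have "xc (En n) (radial_cone (En n) (dom_P_Tjoin n T) (indicator J))
      \<le> card J * (n * n + (n * n + n))"
    using xc_join_cone_le[OF JE J(2)] by simp
  \<comment> \<open>In the naturals \<open>n \<le> n * n\<close>, so
    \<open>2 * n^2 + n \<le> 3 * n^2\<close>; this is the constant 3.\<close>
  also have "\<dots> \<le> card J * (3 * (n * n))" by (intro mult_le_mono2) simp
  finally have "real (xc (En n) (radial_cone (En n) (dom_P_Tjoin n T) (indicator J)))
      \<le> real (card J * (3 * (n * n)))" by (simp only: of_nat_le_iff)
  then show "real (xc (En n) (radial_cone (En n) (dom_P_Tjoin n T) (indicator J)))
      \<le> 3 * real (card J) * real n ^ 2"
    by (simp add: power2_eq_square mult.assoc mult.left_commute)
qed simp

end
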